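(* Let $G$ be a flat affine group scheme of finite type over $\mathbb Z$, let $\pi:G\to M_n$ be a faithful representation, and let $(D,t,f)$ be the triple (a ring $D$ with $t\in D$ and $f\in G(D,tD)$) constructed from $\pi$ as in the context, with elements $y_{ij}\in D$. Then for any commutative ring $R$ and elements $r\in R$ and $h\in G(R,rR)$ there exists a ring homomorphism $\theta:D\to R$ such that $\theta(t)=r$ and $\theta(f)=h$. Moreover, let $\mathfrak a$ be an ideal of a commutative ring $R$, $r\in R$, and $h\in G(R,r\mathfrak a)$. Then there exists a ring homomorphism $\theta:D\to R$ such that $\theta(t)=r$, $\theta(f)=h$, and $\theta(y_{ij})\in\mathfrak a$ for all $i,j=1,\dots,n$.
   Context: Rings are commutative with $1$ and ring homomorphisms preserve $1$. Let $A=\mathbb Z[G]$ be the affine algebra of $G$; elements of $G(R)$ are identified with ring homomorphisms $A\to R$. A ring homomorphism $\theta:D\to R$ induces $G(D)\to G(R)$, $f\mapsto\theta(f)=\theta\circ f$. For an ideal $\mathfrak q$ of $R$, $G(R,\mathfrak q)=\ker(G(R)\to G(R/\mathfrak q))$. A representation of $G$ is a morphism of group schemes $\pi:G\to\mathrm{GL}_n$; it is faithful if it is a monomorphism, i.e. $G(R)\to\mathrm{GL}_n(R)$ is injective for all $R$. Compose with $\mathrm{GL}_n\hookrightarrow M_n$, where $M_n$ is the affine scheme of all $n\times n$ matrices with $\mathbb Z[M_n]=\mathbb Z[z_{ij}\mid 1\le i,j\le n]$; the composite is still denoted $\pi$, with corresponding ring homomorphism $\pi^*:\mathbb Z[M_n]\to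 A$. Construction of $(D,t,f)$: let $\varphi:\mathbb Z[M_n]\to\mathbb Z[t,y_{ij}\mid 1\le i,j\le n]$ send $z_{ij}$ to $\delta_{ij}+ty_{ij}$. Let $D=\mathbb Z[t,y_{ij}]\otimes_{\mathbb Z[M_n]}A$ be the pushout of $\varphi$ and $\pi^*$. The images of $t$ and $y_{ij}$ in $D$ are denoted by the same symbols, and $f\in G(D)$ is the canonical homomorphism $f:A\to D$. Thus $\pi(f)=e+ty$ with $y=(y_{ij})$, where $e$ is the identity matrix, so that $f\in G(D,tD)$. *)

theory Defs
  imports "HOL-Algebra.Algebra" "HOL-Algebra.Algebraic_Closure_Type"
begin

section \<open>Linear extension from free abelian groups\<close>

definition lin_ext :: "('r, 'm) ring_scheme \<Rightarrow> ('k \<Rightarrow> 'r) \<Rightarrow> ('k \<Rightarrow>\<^sub>0 int) \<Rightarrow> 'r" where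
  "lin_ext R F c =
     (\<Oplus>\<^bsub>R\<^esub>k\<in>Poly_Mapping.keys c. add_pow R (Poly_Mapping.lookup c k) (F k))"


section \<open>Tensor products of commutative rings\<close>

text \<open>The monoid ring \<open>\<int>[B \<times> A]\<close> of the multiplicative monoid \<open>B \<times> A\<close>.  As an abelian
  group it is the free abelian group on \<open>B \<times> A\<close>, of which \<open>B \<otimes>\<^sub>C A\<close> is a quotient.\<close>

definition pair_mult ::
    "('b, 'm) monoid_scheme \<Rightarrow> ('a, 'n) monoid_scheme
      \<Rightarrow> ('b \<times> 'a \<Rightarrow>\<^sub>0 int) \<Rightarrow> ('b \<times> 'a \<Rightarrow>\<^sub>0 int) \<Rightarrow> ('b \<times> 'a \<Rightarrow>\<^sub>0 int)" where
  "pair_mult B A c d = frag_extend (\<lambda>(b, a). frag_extend (\<lambda>(b', a').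
     frag_of (b \<otimes>\<^bsub>B\<^esub> b', a \<otimes>\<^bsub>A\<^esub> a')) d) c"

definition pair_ring ::
    "('b, 'm) ring_scheme \<Rightarrow> ('a, 'n) ring_scheme \<Rightarrow> ('b \<times> 'a \<Rightarrow>\<^sub>0 int) ring" where
  "pair_ring B A = \<lparr>
     carrier = {c. Poly_Mapping.keys c \<subseteq> carrier B \<times> carrier A},
     monoid.mult = pair_mult B A,
     monoid.one = frag_of (\<one>\<^bsub>B\<^esub>, \<one>\<^bsub>A\<^esub>),
     ring.zero = 0,
     add = (+)\<rparr>"

definition tensor_rels ::
    "('c, 'k) ring_scheme \<Rightarrow> ('c \<Rightarrow> 'b) \<Rightarrow> ('c \<Rightarrow> 'a)
      \<Rightarrow> ('b, 'm) ring_scheme \<Rightarrow> ('a, 'n) ring_scheme \<Rightarrow> ('b \<times> 'a \<Rightarrow>\<^sub>0 int) set" where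
  "tensor_rels C \<beta> \<alpha> B A =
     {frag_of (b \<oplus>\<^bsub>B\<^esub> b', a) - frag_of (b, a) - frag_of (b', a) | b b' a.
        b \<in> carrier B \<and> b' \<in> carrier B \<and> a \<in> carrier A} \<union>
     {frag_of (b, a \<oplus>\<^bsub>A\<^esub> a') - frag_of (b, a) - frag_of (b, a') | b a a'.
        b \<in> carrier B \<and> a \<in> carrier A \<and> a' \<in> carrier A} \<union>
     {frag_of (b \<otimes>\<^bsub>B\<^esub> \<beta> c, a) - frag_of (b, \<alpha> c \<otimes>\<^bsub>A\<^esub> a) | b c a.
        b \<in> carrier B \<and> c \<in> carrier C \<and> a \<in> carrier A}"

text \<open>\<open>B \<otimes>\<^sub>C A\<close> for ring homomorphisms \<open>\<beta> : C \<rightarrow> B\<close> and \<open>\<alpha> : C \<rightarrow> A\<close>, i.e. their pushout.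
  The subgroup generated by the relations is stable under multiplication by the generators
  \<open>(b, a)\<close>, so dividing by the ideal gives the usual tensor product of \<open>C\<close>-modules.\<close>

definition tensor_ideal where
  "tensor_ideal C \<beta> \<alpha> B A = Idl\<^bsub>pair_ring B A\<^esub> (tensor_rels C \<beta> \<alpha> B A)"

definition tensor_ring ::
    "('c, 'k) ring_scheme \<Rightarrow> ('c \<Rightarrow> 'b) \<Rightarrow> ('c \<Rightarrow> 'a)
      \<Rightarrow> ('b, 'm) ring_scheme \<Rightarrow> ('a, 'n) ring_scheme \<Rightarrow> ('b \<times> 'a \<Rightarrow>\<^sub>0 int) set ring" where
  "tensor_ring C \<beta> \<alpha> B A = pair_ring B A Quot tensor_ideal C \<beta> \<alpha> B A"

definition pure_tensor ::
    "('c, 'k) ring_scheme \<Rightarrow> ('c \<Rightarrow> 'b) \<Rightarrow> ('c \<Rightarrow> 'a) \<Rightarrow> ('b, 'm) ring_scheme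
      \<Rightarrow> ('a, 'n) ring_scheme \<Rightarrow> 'b \<Rightarrow> 'a \<Rightarrow> ('b \<times> 'a \<Rightarrow>\<^sub>0 int) set" where
  "pure_tensor C \<beta> \<alpha> B A b a = tensor_ideal C \<beta> \<alpha> B A +>\<^bsub>pair_ring B A\<^esub> frag_of (b, a)"

text \<open>The homomorphism \<open>b \<otimes> a \<mapsto> g b \<cdot> h a\<close> out of a tensor product; \<open>g\<close> and \<open>h\<close> are expected to
  be ring homomorphisms into \<open>R\<close> that agree on \<open>C\<close>.\<close>

definition copair ::
    "('r, 'm) ring_scheme \<Rightarrow> ('b \<Rightarrow> 'r) \<Rightarrow> ('a \<Rightarrow> 'r) \<Rightarrow> ('b \<times> 'a \<Rightarrow>\<^sub>0 int) set \<Rightarrow> 'r" where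
  "copair R g h T = the_elem (lin_ext R (\<lambda>(b, a). g b \<otimes>\<^bsub>R\<^esub> h a) ` T)"

definition int_map :: "('r, 'm) ring_scheme \<Rightarrow> int \<Rightarrow> 'r" where
  "int_map R k = add_pow R k \<one>\<^bsub>R\<^esub>"

abbreviation tensorZ ::
    "('b, 'm) ring_scheme \<Rightarrow> ('a, 'n) ring_scheme \<Rightarrow> ('b \<times> 'a \<Rightarrow>\<^sub>0 int) set ring" where
  "tensorZ B A \<equiv> tensor_ring \<Z> (int_map B) (int_map A) B A"

abbreviation pureZ ::
    "('b, 'm) ring_scheme \<Rightarrow> ('a, 'n) ring_scheme \<Rightarrow> 'b \<Rightarrow> 'a \<Rightarrow> ('b \<times> 'a \<Rightarrow>\<^sub>0 int) set" where
  "pureZ B A \<equiv> pure_tensor \<Z> (int_map B) (int_map A) B A"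


section \<open>Affine group schemes over the integers\<close>

text \<open>An affine group scheme is given by its affine algebra, a commutative Hopf algebra over
  \<open>\<int>\<close>.\<close>

record 'a group_scheme =
  coord_ring :: "'a ring"
  comult :: "'a \<Rightarrow> ('a \<times> 'a \<Rightarrow>\<^sub>0 int) set"
  counit :: "'a \<Rightarrow> int"
  antipode :: "'a \<Rightarrow> 'a"

text \<open>The three coprojections \<open>j\<^sub>1, j\<^sub>2, j\<^sub>3 : A \<rightarrow> A \<otimes> (A \<otimes> A)\<close> occur in the coassociativity law:
  \<open>copair (copair j\<^sub>1 j\<^sub>2 \<circ> \<Delta>) j\<^sub>3\<close> is \<open>\<Delta> \<otimes> id\<close> followed by the associativity isomorphism
  \<open>(A \<otimes> A) \<otimes> A \<rightarrow> A \<otimes> (A \<otimes> A)\<close>, and \<open>copair j\<^sub>1 (copair j\<^sub>2 j\<^sub>3 \<circ> \<Delta>)\<close> is \<open>id \<otimes> \<Delta>\<close>.\<close>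

definition affine_group_scheme :: "'a group_scheme \<Rightarrow> bool" where
  "affine_group_scheme G \<longleftrightarrow>
     (let A = coord_ring G; \<Delta> = comult G; \<epsilon> = counit G; S = antipode G;
          A2 = tensorZ A A; A3 = tensorZ A A2;
          j1 = (\<lambda>a. pureZ A A2 a \<one>\<^bsub>A2\<^esub>);
          j2 = (\<lambda>a. pureZ A A2 \<one>\<^bsub>A\<^esub> (pureZ A A a \<one>\<^bsub>A\<^esub>));
          j3 = (\<lambda>a. pureZ A A2 \<one>\<^bsub>A\<^esub> (pureZ A A \<one>\<^bsub>A\<^esub> a))
      in cring A \<and>
         \<Delta> \<in> ring_hom A A2 \<and> \<epsilon> \<in> ring_hom A \<Z> \<and> S \<in> ring_hom A A \<and>
         (\<forall>a\<in>carrier A.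
            copair A3 (copair A3 j1 j2 \<circ> \<Delta>) j3 (\<Delta> a) = copair A3 j1 (copair A3 j2 j3 \<circ> \<Delta>) (\<Delta> a) \<and>
            copair A (int_map A \<circ> \<epsilon>) id (\<Delta> a) = a \<and>
            copair A id (int_map A \<circ> \<epsilon>) (\<Delta> a) = a \<and>
            copair A S id (\<Delta> a) = int_map A (\<epsilon> a) \<and>
            copair A id S (\<Delta> a) = int_map A (\<epsilon> a)))"

text \<open>The group \<open>G(R)\<close>.  Homomorphisms are made extensional so that equality of points is
  equality of functions.\<close>

definition points :: "'a group_scheme \<Rightarrow> ('r, 'm) ring_scheme \<Rightarrow> ('a \<Rightarrow> 'r) monoid" where
  "points G R = \<lparr>
     carrier = ring_hom (coord_ring G) R \<inter> extensional (carrier (coord_ring G)),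
     monoid.mult = (\<lambda>g h. \<lambda>a\<in>carrier (coord_ring G). copair R g h (comult G a)),
     monoid.one = (\<lambda>a\<in>carrier (coord_ring G). int_map R (counit G a))\<rparr>"

definition point_map :: "'a group_scheme \<Rightarrow> ('d \<Rightarrow> 'r) \<Rightarrow> ('a \<Rightarrow> 'd) \<Rightarrow> 'a \<Rightarrow> 'r" where
  "point_map G \<theta> f = compose (carrier (coord_ring G)) \<theta> f"

definition congruence_subgroup ::
    "'a group_scheme \<Rightarrow> ('r, 'm) ring_scheme \<Rightarrow> 'r set \<Rightarrow> ('a \<Rightarrow> 'r) set" where
  "congruence_subgroup G R \<qq> =
     kernel (points G R) (points G (R Quot \<qq>)) (point_map G ((+>\<^bsub>R\<^esub>) \<qq>))"

definition finite_type :: "'a group_scheme \<Rightarrow> bool" where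
  "finite_type G \<longleftrightarrow> (\<exists>T. finite T \<and> T \<subseteq> carrier (coord_ring G) \<and>
     generate_ring (coord_ring G) T = carrier (coord_ring G))"


subsection \<open>Flatness\<close>

text \<open>Tensor products \<open>M \<otimes> N\<close> of abelian groups, written multiplicatively.\<close>

definition bilinear_subgroup ::
    "('x, 'm) monoid_scheme \<Rightarrow> ('y, 'n) monoid_scheme \<Rightarrow> ('x \<times> 'y \<Rightarrow>\<^sub>0 int) set" where
  "bilinear_subgroup M N = generate (free_Abelian_group (carrier M \<times> carrier N))
     ({frag_of (x \<otimes>\<^bsub>M\<^esub> x', y) - frag_of (x, y) - frag_of (x', y) | x x' y.
         x \<in> carrier M \<and> x' \<in> carrier M \<and> y \<in> carrier N} \<union>
      {frag_of (x, y \<otimes>\<^bsub>N\<^esub> y') - frag_of (x, y) - frag_of (x, y') | x y y'.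
         x \<in> carrier M \<and> y \<in> carrier N \<and> y' \<in> carrier N})"

definition tensor_group ::
    "('x, 'm) monoid_scheme \<Rightarrow> ('y, 'n) monoid_scheme \<Rightarrow> ('x \<times> 'y \<Rightarrow>\<^sub>0 int) set monoid" where
  "tensor_group M N = free_Abelian_group (carrier M \<times> carrier N) Mod bilinear_subgroup M N"

text \<open>\<open>\<phi> \<otimes> id : M \<otimes> P \<rightarrow> N \<otimes> P\<close> for a homomorphism \<open>\<phi> : M \<rightarrow> N\<close>.\<close>

definition tensor_group_map ::
    "('z, 'k) monoid_scheme \<Rightarrow> ('y, 'n) monoid_scheme \<Rightarrow> ('x \<Rightarrow> 'z)
      \<Rightarrow> ('x \<times> 'y \<Rightarrow>\<^sub>0 int) set \<Rightarrow> ('z \<times> 'y \<Rightarrow>\<^sub>0 int) set" where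
  "tensor_group_map N P \<phi> T =
     bilinear_subgroup N P <#>\<^bsub>free_Abelian_group (carrier N \<times> carrier P)\<^esub>
       frag_extend (\<lambda>(x, y). frag_of (\<phi> x, y)) ` T"

text \<open>The definition of flatness asks that \<open>_ \<otimes> A\<close> preserve injectivity for all abelian groups; here
  \<open>M\<close> and \<open>N\<close> range over those whose underlying set is a set of integers, i.e. up to isomorphism
  over all countable ones.  By the ideal criterion the inclusions of the ideals of \<open>\<int>\<close> into \<open>\<int>\<close>
  already suffice, so nothing is lost.\<close>

definition flat :: "'a group_scheme \<Rightarrow> bool" where
  "flat G \<longleftrightarrow> (\<forall>(M :: int monoid) (N :: int monoid) \<phi>.
     comm_group M \<and> comm_group N \<and> \<phi> \<in> mon M N \<longrightarrow>
       inj_on (tensor_group_map N (add_monoid (coord_ring G)) \<phi>)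
         (carrier (tensor_group M (add_monoid (coord_ring G)))))"


section \<open>Polynomial rings and matrices\<close>

text \<open>\<open>\<int>[v | v \<in> 'v]\<close>\<close>

type_synonym 'v poly_int = "('v \<Rightarrow>\<^sub>0 nat) \<Rightarrow>\<^sub>0 int"

abbreviation poly_ring :: "'v poly_int ring" where
  "poly_ring \<equiv> ring_of_type_algebra"

definition pvar :: "'v \<Rightarrow> 'v poly_int" where
  "pvar v = frag_of (Poly_Mapping.single v 1)"

definition poly_eval :: "('r, 'm) ring_scheme \<Rightarrow> ('v \<Rightarrow> 'r) \<Rightarrow> 'v poly_int \<Rightarrow> 'r" where
  "poly_eval R \<rho> =
     lin_ext R (\<lambda>m. \<Otimes>\<^bsub>R\<^esub>v\<in>Poly_Mapping.keys m. \<rho> v [^]\<^bsub>R\<^esub> Poly_Mapping.lookup m v)"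

text \<open>\<open>M\<^sub>n\<close> is modelled with rows and columns indexed by a finite type \<open>'n\<close>, with \<open>n = CARD('n)\<close>;
  \<open>\<int>[M\<^sub>n]\<close> is \<open>poly_ring\<close> on the variables \<open>'n \<times> 'n\<close>.\<close>

definition mat_monoid :: "('r, 'm) ring_scheme \<Rightarrow> ('n::finite \<Rightarrow> 'n \<Rightarrow> 'r) monoid" where
  "mat_monoid R = \<lparr>
     carrier = {M. \<forall>i j. M i j \<in> carrier R},
     monoid.mult = (\<lambda>M N i j. \<Oplus>\<^bsub>R\<^esub>k\<in>UNIV. M i k \<otimes>\<^bsub>R\<^esub> N k j),
     monoid.one = (\<lambda>i j. if i = j then \<one>\<^bsub>R\<^esub> else \<zero>\<^bsub>R\<^esub>)\<rparr>"

definition GL :: "('r, 'm) ring_scheme \<Rightarrow> ('n::finite \<Rightarrow> 'n \<Rightarrow> 'r) monoid" where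
  "GL R = units_of (mat_monoid R)"


section \<open>Representations\<close>

text \<open>A morphism \<open>\<pi> : G \<rightarrow> M\<^sub>n\<close> is given by \<open>\<pi>\<^sup>* : \<int>[M\<^sub>n] \<rightarrow> A\<close>, which sends the point \<open>g : A \<rightarrow> R\<close>
  to the matrix \<open>(g (\<pi>\<^sup>* z\<^sub>i\<^sub>j))\<close>.\<close>

definition rep_matrix :: "(('n \<times> 'n) poly_int \<Rightarrow> 'a) \<Rightarrow> ('a \<Rightarrow> 'r) \<Rightarrow> 'n \<Rightarrow> 'n \<Rightarrow> 'r" where
  "rep_matrix \<pi> g = (\<lambda>i j. g (\<pi> (pvar (i, j))))"

text \<open>Being a homomorphism \<open>G(R) \<rightarrow> GL\<^sub>n(R)\<close>, and being injective, must hold for all commutative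
  rings \<open>R\<close>.  HOL cannot quantify over types inside a definition, so below \<open>R\<close> ranges over all
  commutative rings carried by the type of \<open>A \<otimes> A\<close>.  No generality is lost, because the
  universal cases, the tensor products of \<open>A\<close> with itself over \<open>\<int>\<close> and over \<open>\<int>[M\<^sub>n]\<close>, are among them: the theorems
  \<open>representation_all\<close> and \<open>faithful_all\<close> below derive both properties for rings over any
  type.\<close>

definition representation ::
    "'a group_scheme \<Rightarrow> (('n::finite \<times> 'n) poly_int \<Rightarrow> 'a) \<Rightarrow> bool" where
  "representation G \<pi> \<longleftrightarrow>
     \<pi> \<in> ring_hom poly_ring (coord_ring G) \<and>
     (\<forall>R :: ('a \<times> 'a \<Rightarrow>\<^sub>0 int) set ring.
        cring R \<longrightarrow> rep_matrix \<pi> \<in> hom (points G R) (GL R))"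

definition faithful_representation ::
    "'a group_scheme \<Rightarrow> (('n::finite \<times> 'n) poly_int \<Rightarrow> 'a) \<Rightarrow> bool" where
  "faithful_representation G \<pi> \<longleftrightarrow>
     representation G \<pi> \<and>
     (\<forall>R :: ('a \<times> 'a \<Rightarrow>\<^sub>0 int) set ring.
        cring R \<longrightarrow> inj_on (rep_matrix \<pi>) (carrier (points G R)))"


section \<open>The triple \<open>(D, t, f)\<close>\<close>

text \<open>\<open>\<int>[t, y\<^sub>i\<^sub>j]\<close> is \<open>poly_ring\<close> on the variables \<open>('n \<times> 'n) option\<close>, with \<open>None\<close> for \<open>t\<close> and
  \<open>Some (i, j)\<close> for \<open>y\<^sub>i\<^sub>j\<close>.\<close>

definition phi :: "('n \<times> 'n) poly_int \<Rightarrow> ('n \<times> 'n) option poly_int" where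
  "phi = poly_eval poly_ring
     (\<lambda>(i, j). (if i = j then 1 else 0) + pvar None * pvar (Some (i, j)))"

definition D_ring ::
    "'a group_scheme \<Rightarrow> (('n \<times> 'n) poly_int \<Rightarrow> 'a)
      \<Rightarrow> (('n \<times> 'n) option poly_int \<times> 'a \<Rightarrow>\<^sub>0 int) set ring" where
  "D_ring G \<pi> = tensor_ring poly_ring phi \<pi> poly_ring (coord_ring G)"

definition D_poly ::
    "'a group_scheme \<Rightarrow> (('n \<times> 'n) poly_int \<Rightarrow> 'a) \<Rightarrow> ('n \<times> 'n) option poly_int
      \<Rightarrow> (('n \<times> 'n) option poly_int \<times> 'a \<Rightarrow>\<^sub>0 int) set" where
  "D_poly G \<pi> p = pure_tensor poly_ring phi \<pi> poly_ring (coord_ring G) p \<one>\<^bsub>coord_ring G\<^esub>"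

definition D_t where
  "D_t G \<pi> = D_poly G \<pi> (pvar None)"

definition D_y where
  "D_y G \<pi> i j = D_poly G \<pi> (pvar (Some (i, j)))"

definition D_f ::
    "'a group_scheme \<Rightarrow> (('n \<times> 'n) poly_int \<Rightarrow> 'a)
      \<Rightarrow> 'a \<Rightarrow> (('n \<times> 'n) option poly_int \<times> 'a \<Rightarrow>\<^sub>0 int) set" where
  "D_f G \<pi> = (\<lambda>a\<in>carrier (coord_ring G).
     pure_tensor poly_ring phi \<pi> poly_ring (coord_ring G) 1 a)"


section \<open>Basic properties\<close>

context ring
begin

lemma add_pow_zero_int: "x \<in> carrier R \<Longrightarrow> add_pow R (0::int) x = \<zero>"
  by (simp add: add_pow_def)

lemma lin_ext_superset:
  assumes "finite K" "Poly_Mapping.keys c \<subseteq> K" "F \<in> K \<rightarrow> carrier R"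
  shows "lin_ext R F c = (\<Oplus>k\<in>K. add_pow R (Poly_Mapping.lookup c k) (F k))"
  unfolding lin_ext_def
  by (rule add.finprod_mono_neutral_cong_left) (use assms in \<open>auto simp: in_keys_iff Pi_iff add_pow_zero_int\<close>)

lemma lin_ext_closed [intro, simp]:
  assumes "F \<in> Poly_Mapping.keys c \<rightarrow> carrier R"
  shows "lin_ext R F c \<in> carrier R"
  unfolding lin_ext_def using assms by (auto intro!: finsum_closed)

lemma lin_ext_add:
  assumes "Poly_Mapping.keys c \<subseteq> S" "Poly_Mapping.keys d \<subseteq> S" "F \<in> S \<rightarrow> carrier R"
  shows "lin_ext R F (c + d) = lin_ext R F c \<oplus> lin_ext R F d"
proof -
  let ?K = "Poly_Mapping.keys c \<union> Poly_Mapping.keys d"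
  have F: "F \<in> ?K \<rightarrow> carrier R" using assms by auto
  have "lin_ext R F (c + d) = (\<Oplus>k\<in>?K. add_pow R (Poly_Mapping.lookup (c + d) k) (F k))"
    by (rule lin_ext_superset) (use F Poly_Mapping.keys_add[of c d] in auto)
  also have "\<dots> = (\<Oplus>k\<in>?K. add_pow R (Poly_Mapping.lookup c k) (F k) \<oplus> add_pow R (Poly_Mapping.lookup d k) (F k))"
    by (rule finsum_cong') (use F in \<open>auto simp: lookup_add add.int_pow_mult Pi_iff\<close>)
  also have "\<dots> = (\<Oplus>k\<in>?K. add_pow R (Poly_Mapping.lookup c k) (F k)) \<oplus>
                  (\<Oplus>k\<in>?K. add_pow R (Poly_Mapping.lookup d k) (F k))"
    by (rule finsum_addf) (use F in \<open>auto simp: Pi_iff\<close>)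
  also have "\<dots> = lin_ext R F c \<oplus> lin_ext R F d"
    by (subst (1 2) lin_ext_superset[of ?K]) (use F in auto)
  finally show ?thesis .
qed

lemma lin_ext_zero [simp]: "lin_ext R F 0 = \<zero>"
  by (simp add: lin_ext_def)

lemma lin_ext_of [simp]:
  assumes "F k \<in> carrier R"
  shows "lin_ext R F (frag_of k) = F k"
proof -
  have "lin_ext R F (frag_of k) = (\<Oplus>j\<in>{k}. add_pow R (Poly_Mapping.lookup (frag_of k) j) (F j))"
    by (rule lin_ext_superset) (use assms in auto)
  then show ?thesis using assms by simp
qed

lemma lin_ext_diff:
  assumes "Poly_Mapping.keys c \<subseteq> S" "Poly_Mapping.keys d \<subseteq> S" "F \<in> S \<rightarrow> carrier R"
  shows "lin_ext R F (c - d) = lin_ext R F c \<ominus> lin_ext R F d"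
proof -
  have k: "Poly_Mapping.keys (c - d) \<subseteq> S" using keys_diff[of c d] assms by auto
  have cl: "lin_ext R F x \<in> carrier R" if "Poly_Mapping.keys x \<subseteq> S" for x
    using that assms(3) by (intro lin_ext_closed) auto
  have "lin_ext R F c = lin_ext R F (c - d) \<oplus> lin_ext R F d"
    using lin_ext_add[OF k assms(2,3)] by simp
  then show ?thesis using cl k assms by (simp add: minus_eq a_assoc r_neg)
qed

end

lemma additive_eq_lin_ext:
  fixes R (structure)
  assumes "ring R" and cl: "\<And>c. Poly_Mapping.keys c \<subseteq> S \<Longrightarrow> k c \<in> carrier R"
    and add: "\<And>c d. Poly_Mapping.keys c \<subseteq> S \<Longrightarrow> Poly_Mapping.keys d \<subseteq> S \<Longrightarrow> k (c + d) = k c \<oplus> k d"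
    and c: "Poly_Mapping.keys c \<subseteq> S"
  shows "k c = lin_ext R (\<lambda>x. k (frag_of x)) c"
proof -
  interpret ring R by fact
  have k0: "k 0 = \<zero>"
    using add[of 0 0] cl[of 0] by (simp add: add.l_cancel_one')
  have F: "(\<lambda>x. k (frag_of x)) \<in> S \<rightarrow> carrier R" using cl by auto
  from c have "Poly_Mapping.keys c \<subseteq> S \<and> k c = lin_ext R (\<lambda>x. k (frag_of x)) c"
  proof (induction c rule: frag_induction)
    case zero then show ?case by (simp add: k0)
  next
    case (one x) then show ?case using cl[of "frag_of x"] by simp
  next
    case (diff a b)
    have kk: "Poly_Mapping.keys (a - b) \<subseteq> S" using keys_diff[of a b] diff by auto
    have ab: "Poly_Mapping.keys a \<subseteq> S" "Poly_Mapping.keys b \<subseteq> S" using diff by auto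
    have "k a = k (a - b) \<oplus> k b" using add[of "a - b" b] kk ab by simp
    then have "k (a - b) = k a \<ominus> k b"
      using cl kk ab by (simp add: minus_eq a_assoc r_neg)
    then show ?case using kk diff lin_ext_diff[OF _ _ F, of a b] by simp
  qed
  then show ?thesis ..
qed

lemma pair_mult_diff_left: "pair_mult B A (c - c') d = pair_mult B A c d - pair_mult B A c' d"
  by (simp add: pair_mult_def frag_extend_diff)

lemma pair_mult_diff_right: "pair_mult B A c (d - d') = pair_mult B A c d - pair_mult B A c d'"
  using subset_UNIV
proof (induction c rule: frag_induction)
  case (diff a b) then show ?case by (simp add: pair_mult_diff_left)
qed (auto simp: pair_mult_def frag_extend_diff)

lemma pair_mult_0 [simp]: "pair_mult B A 0 d = 0" "pair_mult B A c 0 = 0"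
  using pair_mult_diff_left[of B A 0 0 d] pair_mult_diff_right[of B A c 0 0] by auto

lemma pair_mult_of [simp]: "pair_mult B A (frag_of (b,a)) (frag_of (b',a')) = frag_of (b \<otimes>\<^bsub>B\<^esub> b', a \<otimes>\<^bsub>A\<^esub> a')"
  by (simp add: pair_mult_def)

lemma pair_mult_add_left: "pair_mult B A (c + c') d = pair_mult B A c d + pair_mult B A c' d"
  by (simp add: pair_mult_def frag_extend_add)

lemma pair_ring_simps:
  "carrier (pair_ring B A) = {c. Poly_Mapping.keys c \<subseteq> carrier B \<times> carrier A}"
  "c \<otimes>\<^bsub>pair_ring B A\<^esub> d = pair_mult B A c d"
  "\<one>\<^bsub>pair_ring B A\<^esub> = frag_of (\<one>\<^bsub>B\<^esub>, \<one>\<^bsub>A\<^esub>)"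
  "\<zero>\<^bsub>pair_ring B A\<^esub> = 0"
  "c \<oplus>\<^bsub>pair_ring B A\<^esub> d = c + d"
  by (simp_all add: pair_ring_def pair_mult_def)

lemma pair_ring_cring:
  assumes "cring B" "cring A"
  shows "cring (pair_ring B A)"
proof -
  interpret B: cring B by fact
  interpret A: cring A by fact
  let ?S = "carrier B \<times> carrier A"
  have closed: "Poly_Mapping.keys (pair_mult B A c d) \<subseteq> ?S"
    if "Poly_Mapping.keys c \<subseteq> ?S" "Poly_Mapping.keys d \<subseteq> ?S" for c d
    using that(1)
  proof (induction c rule: frag_induction)
    case (one x)
    show ?case using that(2)
    proof (induction d rule: frag_induction)
      case (one y) then show ?case using \<open>x \<in> ?S\<close> by (cases x; cases y) auto
    next
      case (diff a b) then show ?case using keys_diff[of "pair_mult B A (frag_of x) a" "pair_mult B A (frag_of x) b"]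
        by (auto simp: pair_mult_diff_right)
    qed auto
  next
    case (diff a b) then show ?case using keys_diff[of "pair_mult B A a d" "pair_mult B A b d"]
        by (auto simp: pair_mult_diff_left)
  qed auto
  have comm: "pair_mult B A c d = pair_mult B A d c"
    if "Poly_Mapping.keys c \<subseteq> ?S" "Poly_Mapping.keys d \<subseteq> ?S" for c d
    using that(1)
  proof (induction c rule: frag_induction)
    case (one x)
    show ?case using that(2)
    proof (induction d rule: frag_induction)
      case (one y) then show ?case using \<open>x \<in> ?S\<close> by (cases x; cases y) (auto simp: A.m_comm B.m_comm)
    qed (auto simp: pair_mult_diff_right pair_mult_diff_left)
  qed (auto simp: pair_mult_diff_right pair_mult_diff_left)
  have assoc: "pair_mult B A (pair_mult B A c d) e = pair_mult B A c (pair_mult B A d e)"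
    if "Poly_Mapping.keys c \<subseteq> ?S" "Poly_Mapping.keys d \<subseteq> ?S" "Poly_Mapping.keys e \<subseteq> ?S" for c d e
    using that(1)
  proof (induction c rule: frag_induction)
    case (one x)
    show ?case using that(2)
    proof (induction d rule: frag_induction)
      case (one y)
      show ?case using that(3)
      proof (induction e rule: frag_induction)
        case (one z) then show ?case using \<open>x \<in> ?S\<close> \<open>y \<in> ?S\<close>
          by (cases x; cases y; cases z) (auto simp: A.m_assoc B.m_assoc)
      qed (auto simp: pair_mult_diff_right pair_mult_diff_left)
    qed (auto simp: pair_mult_diff_right pair_mult_diff_left)
  qed (auto simp: pair_mult_diff_right pair_mult_diff_left)
  have one: "pair_mult B A (frag_of (\<one>\<^bsub>B\<^esub>, \<one>\<^bsub>A\<^esub>)) c = c" if "Poly_Mapping.keys c \<subseteq> ?S" for c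
    using that by (induction c rule: frag_induction) (auto simp: pair_mult_diff_right)
  show ?thesis
  proof (rule cringI)
    show "abelian_group (pair_ring B A)"
    proof (rule abelian_groupI, unfold pair_ring_simps)
      fix x :: "('a \<times> 'c) \<Rightarrow>\<^sub>0 int" assume "x \<in> {c. Poly_Mapping.keys c \<subseteq> ?S}"
      then show "\<exists>y\<in>{c. Poly_Mapping.keys c \<subseteq> ?S}. y + x = 0"
        by (intro bexI[of _ "- x"]) auto
    qed (auto simp: algebra_simps dest!: subsetD[OF Poly_Mapping.keys_add])
    show "Group.comm_monoid (pair_ring B A)"
      by (rule comm_monoidI, unfold pair_ring_simps) (use closed assoc one comm in auto)
  qed (auto simp: pair_ring_simps pair_mult_add_left)
qed

lemma lin_ext_pair_hom:
  fixes R (structure)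
  assumes "cring R" "cring B" "cring A" and g: "g \<in> ring_hom B R" and h: "h \<in> ring_hom A R"
  shows "lin_ext R (\<lambda>(b, a). g b \<otimes> h a) \<in> ring_hom (pair_ring B A) R"
proof -
  interpret R: cring R by fact
  interpret B: cring B by fact
  interpret A: cring A by fact
  interpret P: cring "pair_ring B A" by (rule pair_ring_cring) fact+
  let ?S = "carrier B \<times> carrier A"
  let ?F = "\<lambda>(b, a). g b \<otimes> h a"
  let ?L = "lin_ext R ?F"
  have gc: "g b \<in> carrier R" if "b \<in> carrier B" for b using g that by (rule ring_hom_closed)
  have hc: "h b \<in> carrier R" if "b \<in> carrier A" for b using h that by (rule ring_hom_closed)
  have F: "?F \<in> ?S \<rightarrow> carrier R" using gc hc by auto
  have cl: "?L c \<in> carrier R" if "Poly_Mapping.keys c \<subseteq> ?S" for c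
    by (rule R.lin_ext_closed, rule Pi_I, rule funcset_mem[OF F]) (use that in auto)
  have kcl: "Poly_Mapping.keys (pair_mult B A c d) \<subseteq> ?S"
    if "Poly_Mapping.keys c \<subseteq> ?S" "Poly_Mapping.keys d \<subseteq> ?S" for c d
    using P.m_closed[of c d] that by (simp add: pair_ring_simps)
  have mult: "?L (pair_mult B A c d) = ?L c \<otimes> ?L d"
    if c: "Poly_Mapping.keys c \<subseteq> ?S" and d: "Poly_Mapping.keys d \<subseteq> ?S" for c d
  proof -
    from c have "Poly_Mapping.keys c \<subseteq> ?S \<and> ?L (pair_mult B A c d) = ?L c \<otimes> ?L d"
    proof (induction c rule: frag_induction)
      case zero then show ?case using cl[OF d] by simp
    next
      case (one x)
      from d have "Poly_Mapping.keys d \<subseteq> ?S \<and>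
          ?L (pair_mult B A (frag_of x) d) = ?L (frag_of x) \<otimes> ?L d"
      proof (induction d rule: frag_induction)
        case zero then show ?case using F one cl[of "frag_of x"] by simp
      next
        case (one y)
        obtain b a b' a' where xy: "x = (b, a)" "y = (b', a')" by fastforce
        then have c: "b \<in> carrier B" "b' \<in> carrier B" "a \<in> carrier A" "a' \<in> carrier A"
          using one \<open>x \<in> ?S\<close> by auto
        show ?case unfolding xy using c gc hc
          by (auto simp: R.lin_ext_of ring_hom_mult[OF g] ring_hom_mult[OF h] R.m_ac)
      next
        case (diff p q)
        then have pq: "Poly_Mapping.keys p \<subseteq> ?S" "Poly_Mapping.keys q \<subseteq> ?S" by auto
        have x: "Poly_Mapping.keys (frag_of x) \<subseteq> ?S" using one by auto
        show ?case using pq keys_diff[of p q] diff cl[OF pq(1)] cl[OF pq(2)] cl[OF x]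
          by (auto simp: pair_mult_diff_right R.lin_ext_diff[OF kcl[OF x pq(1)] kcl[OF x pq(2)] F]
              R.lin_ext_diff[OF pq F] R.r_distr R.minus_eq R.r_minus)
      qed
      then show ?case using one by auto
    next
      case (diff p q)
      then have pq: "Poly_Mapping.keys p \<subseteq> ?S" "Poly_Mapping.keys q \<subseteq> ?S" by auto
      show ?case using pq keys_diff[of p q] diff cl[OF pq(1)] cl[OF pq(2)] cl[OF d]
        by (auto simp: pair_mult_diff_left R.lin_ext_diff[OF kcl[OF pq(1) d] kcl[OF pq(2) d] F]
            R.lin_ext_diff[OF pq F] R.l_distr R.minus_eq R.l_minus)
    qed
    then show ?thesis ..
  qed
  show ?thesis
  proof (rule ring_hom_memI, unfold pair_ring_simps)
    show "?L (frag_of (\<one>\<^bsub>B\<^esub>, \<one>\<^bsub>A\<^esub>)) = \<one>"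
      by (simp add: ring_hom_one[OF g] ring_hom_one[OF h])
  qed (auto simp: cl mult R.lin_ext_add[OF _ _ F])
qed

locale tensor_data = A: cring A + B: cring B
  for B :: "('b, 'm) ring_scheme" and A :: "('a, 'n) ring_scheme" +
  fixes C :: "('c, 'k) ring_scheme" and \<beta> \<alpha>
  assumes beta: "\<beta> \<in> carrier C \<rightarrow> carrier B" and alpha: "\<alpha> \<in> carrier C \<rightarrow> carrier A"
begin

abbreviation "P \<equiv> pair_ring B A"
abbreviation "T \<equiv> tensor_ring C \<beta> \<alpha> B A"
abbreviation "J \<equiv> tensor_ideal C \<beta> \<alpha> B A"
abbreviation "pt \<equiv> pure_tensor C \<beta> \<alpha> B A"

sublocale P: cring P
  by (rule pair_ring_cring) (rule B.is_cring A.is_cring)+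

lemma tensor_rels_cases [consumes 1]:
  assumes "x \<in> tensor_rels C \<beta> \<alpha> B A"
  obtains
    b b' a where "x = frag_of (b \<oplus>\<^bsub>B\<^esub> b', a) - frag_of (b, a) - frag_of (b', a)"
      "b \<in> carrier B" "b' \<in> carrier B" "a \<in> carrier A"
  | b a a' where "x = frag_of (b, a \<oplus>\<^bsub>A\<^esub> a') - frag_of (b, a) - frag_of (b, a')"
      "b \<in> carrier B" "a \<in> carrier A" "a' \<in> carrier A"
  | b c a where "x = frag_of (b \<otimes>\<^bsub>B\<^esub> \<beta> c, a) - frag_of (b, \<alpha> c \<otimes>\<^bsub>A\<^esub> a)"
      "b \<in> carrier B" "c \<in> carrier C" "a \<in> carrier A"
  using assms unfolding tensor_rels_def by blast

lemma rels_closed: "tensor_rels C \<beta> \<alpha> B A \<subseteq> carrier P"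
proof -
  have d3: "frag_of x - frag_of y - frag_of z \<in> carrier P"
    if "x \<in> carrier B \<times> carrier A" "y \<in> carrier B \<times> carrier A" "z \<in> carrier B \<times> carrier A"
    for x y z :: "'b \<times> 'a"
    using keys_diff[of "frag_of x - frag_of y" "frag_of z"] keys_diff[of "frag_of x" "frag_of y"]
      that by (auto simp: pair_ring_simps)
  have d2: "frag_of x - frag_of y \<in> carrier P"
    if "x \<in> carrier B \<times> carrier A" "y \<in> carrier B \<times> carrier A" for x y :: "'b \<times> 'a"
    using keys_diff[of "frag_of x" "frag_of y"] that by (auto simp: pair_ring_simps)
  show ?thesis
  proof
    fix x assume "x \<in> tensor_rels C \<beta> \<alpha> B A"
    then show "x \<in> carrier P"
      by (cases rule: tensor_rels_cases) (use alpha beta in \<open>auto intro!: d3 d2\<close>)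
  qed
qed

sublocale J: ideal J P
  unfolding tensor_ideal_def by (rule P.genideal_ideal[OF rels_closed])

sublocale T: cring T
  unfolding tensor_ring_def by (rule J.quotient_is_cring) (rule P.is_cring)

lemma proj_hom: "(\<lambda>x. J +>\<^bsub>P\<^esub> x) \<in> ring_hom P T"
  unfolding tensor_ring_def by (rule J.rcos_ring_hom)

lemma carrier_T: "Z \<in> carrier T \<Longrightarrow> \<exists>x\<in>carrier P. Z = J +>\<^bsub>P\<^esub> x"
  unfolding tensor_ring_def FactRing_def A_RCOSETS_def' by auto

lemma frag_closed: "b \<in> carrier B \<Longrightarrow> a \<in> carrier A \<Longrightarrow> frag_of (b, a) \<in> carrier P"
  by (simp add: pair_ring_simps)

lemma pt_closed [intro, simp]: "b \<in> carrier B \<Longrightarrow> a \<in> carrier A \<Longrightarrow> pt b a \<in> carrier T"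
  unfolding pure_tensor_def by (rule ring_hom_closed[OF proj_hom frag_closed])

lemma pt_mult:
  "b \<in> carrier B \<Longrightarrow> a \<in> carrier A \<Longrightarrow> b' \<in> carrier B \<Longrightarrow> a' \<in> carrier A \<Longrightarrow>
    pt b a \<otimes>\<^bsub>T\<^esub> pt b' a' = pt (b \<otimes>\<^bsub>B\<^esub> b') (a \<otimes>\<^bsub>A\<^esub> a')"
  unfolding pure_tensor_def
  by (subst ring_hom_mult[OF proj_hom, symmetric]) (auto simp: frag_closed pair_ring_simps)

lemma pt_one: "pt \<one>\<^bsub>B\<^esub> \<one>\<^bsub>A\<^esub> = \<one>\<^bsub>T\<^esub>"
  using ring_hom_one[OF proj_hom] by (simp add: pure_tensor_def pair_ring_simps)

lemma P_minus: "x \<in> carrier P \<Longrightarrow> y \<in> carrier P \<Longrightarrow> x \<ominus>\<^bsub>P\<^esub> y = x - y"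
proof -
  assume c: "x \<in> carrier P" "y \<in> carrier P"
  have "- y \<in> carrier P" using c by (simp add: pair_ring_simps)
  then have "\<ominus>\<^bsub>P\<^esub> y = - y"
    using c by (intro P.minus_equality) (auto simp: pair_ring_simps)
  then show ?thesis using c by (simp add: P.minus_eq) (simp add: pair_ring_simps)
qed

lemma proj_eqI:
  assumes "x \<in> carrier P" "y \<in> carrier P" "x - y \<in> J"
  shows "J +>\<^bsub>P\<^esub> x = J +>\<^bsub>P\<^esub> y"
  using assms P_minus P.quotient_eq_iff_same_a_r_cos[OF J.is_ideal] by auto

lemma rels_J: "x \<in> tensor_rels C \<beta> \<alpha> B A \<Longrightarrow> x \<in> J"
  unfolding tensor_ideal_def using P.genideal_self[OF rels_closed] by auto

lemma pt_add_left:
  assumes "b \<in> carrier B" "b' \<in> carrier B" "a \<in> carrier A"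
  shows "pt (b \<oplus>\<^bsub>B\<^esub> b') a = pt b a \<oplus>\<^bsub>T\<^esub> pt b' a"
proof -
  have "pt b a \<oplus>\<^bsub>T\<^esub> pt b' a = J +>\<^bsub>P\<^esub> (frag_of (b, a) + frag_of (b', a))"
    unfolding pure_tensor_def using assms
    by (subst ring_hom_add[OF proj_hom, symmetric]) (auto simp: frag_closed pair_ring_simps)
  moreover have "pt (b \<oplus>\<^bsub>B\<^esub> b') a = J +>\<^bsub>P\<^esub> (frag_of (b, a) + frag_of (b', a))"
    unfolding pure_tensor_def
  proof (rule proj_eqI)
    show "frag_of (b, a) + frag_of (b', a) \<in> carrier P"
      using P.a_closed[OF frag_closed frag_closed, of b a b' a] assms by (simp add: pair_ring_simps)
    have "frag_of (b \<oplus>\<^bsub>B\<^esub> b', a) - frag_of (b, a) - frag_of (b', a) \<in> tensor_rels C \<beta> \<alpha> B A"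
      using assms unfolding tensor_rels_def by blast
    then show "frag_of (b \<oplus>\<^bsub>B\<^esub> b', a) - (frag_of (b, a) + frag_of (b', a)) \<in> J"
      using rels_J by (simp add: algebra_simps)
  qed (use assms frag_closed in auto)
  ultimately show ?thesis by simp
qed

lemma pt_add_right:
  assumes "b \<in> carrier B" "a \<in> carrier A" "a' \<in> carrier A"
  shows "pt b (a \<oplus>\<^bsub>A\<^esub> a') = pt b a \<oplus>\<^bsub>T\<^esub> pt b a'"
proof -
  have "pt b a \<oplus>\<^bsub>T\<^esub> pt b a' = J +>\<^bsub>P\<^esub> (frag_of (b, a) + frag_of (b, a'))"
    unfolding pure_tensor_def using assms
    by (subst ring_hom_add[OF proj_hom, symmetric]) (auto simp: frag_closed pair_ring_simps)
  moreover have "pt b (a \<oplus>\<^bsub>A\<^esub> a') = J +>\<^bsub>P\<^esub> (frag_of (b, a) + frag_of (b, a'))"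
    unfolding pure_tensor_def
  proof (rule proj_eqI)
    show "frag_of (b, a) + frag_of (b, a') \<in> carrier P"
      using P.a_closed[OF frag_closed frag_closed, of b a b a'] assms by (simp add: pair_ring_simps)
    have "frag_of (b, a \<oplus>\<^bsub>A\<^esub> a') - frag_of (b, a) - frag_of (b, a') \<in> tensor_rels C \<beta> \<alpha> B A"
      using assms unfolding tensor_rels_def by blast
    then show "frag_of (b, a \<oplus>\<^bsub>A\<^esub> a') - (frag_of (b, a) + frag_of (b, a')) \<in> J"
      using rels_J by (simp add: algebra_simps)
  qed (use assms frag_closed in auto)
  ultimately show ?thesis by simp
qed

lemma pt_balanced:
  assumes "b \<in> carrier B" "c \<in> carrier C" "a \<in> carrier A"
  shows "pt (b \<otimes>\<^bsub>B\<^esub> \<beta> c) a = pt b (\<alpha> c \<otimes>\<^bsub>A\<^esub> a)"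
  unfolding pure_tensor_def
proof (rule proj_eqI)
  show "frag_of (b \<otimes>\<^bsub>B\<^esub> \<beta> c, a) - frag_of (b, \<alpha> c \<otimes>\<^bsub>A\<^esub> a) \<in> J"
    by (rule rels_J) (use assms in \<open>unfold tensor_rels_def, blast\<close>)
qed (use assms frag_closed beta alpha in \<open>auto simp: Pi_iff\<close>)

lemma inL_hom: "(\<lambda>b. pt b \<one>\<^bsub>A\<^esub>) \<in> ring_hom B T"
  by (rule ring_hom_memI) (auto simp: pt_mult pt_add_left pt_one)

lemma inR_hom: "(\<lambda>a. pt \<one>\<^bsub>B\<^esub> a) \<in> ring_hom A T"
  by (rule ring_hom_memI) (auto simp: pt_mult pt_add_right pt_one)

lemma in_commute: "c \<in> carrier C \<Longrightarrow> pt (\<beta> c) \<one>\<^bsub>A\<^esub> = pt \<one>\<^bsub>B\<^esub> (\<alpha> c)"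
  using pt_balanced[of "\<one>\<^bsub>B\<^esub>" c "\<one>\<^bsub>A\<^esub>"] beta alpha by (auto simp: Pi_iff)

lemma
  fixes R (structure)
  assumes R: "cring R" and g: "g \<in> ring_hom B R" and h: "h \<in> ring_hom A R"
    and eq: "\<And>c. c \<in> carrier C \<Longrightarrow> g (\<beta> c) = h (\<alpha> c)"
  shows copair_hom: "copair R g h \<in> ring_hom T R"
    and copair_pt: "\<And>b a. b \<in> carrier B \<Longrightarrow> a \<in> carrier A \<Longrightarrow> copair R g h (pt b a) = g b \<otimes> h a"
proof -
  interpret R: cring R by fact
  let ?F = "\<lambda>(b, a). g b \<otimes> h a"
  let ?L = "lin_ext R ?F"
  have L: "?L \<in> ring_hom P R"
    by (rule lin_ext_pair_hom) (rule R B.is_cring A.is_cring g h)+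
  interpret L: ring_hom_ring P R ?L
    by (rule ring_hom_ringI2[OF P.ring_axioms R.ring_axioms L])
  have gc: "g b \<in> carrier R" if "b \<in> carrier B" for b using g that by (rule ring_hom_closed)
  have hc: "h b \<in> carrier R" if "b \<in> carrier A" for b using h that by (rule ring_hom_closed)
  have bc: "\<beta> c \<in> carrier B" "\<alpha> c \<in> carrier A" if "c \<in> carrier C" for c
    using that beta alpha by auto
  have Lf: "?L (frag_of (b, a)) = g b \<otimes> h a" if "b \<in> carrier B" "a \<in> carrier A" for b a
    using that gc hc by (subst R.lin_ext_of) auto
  have Ld: "?L (x - y) = ?L x \<ominus> ?L y" if "x \<in> carrier P" "y \<in> carrier P" for x y
    using that P_minus[OF that] by (metis L.hom_a_inv L.hom_add P.a_inv_closed P.minus_eq R.minus_eq)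
  have dc: "x - y \<in> carrier P" if "x \<in> carrier P" "y \<in> carrier P" for x y
    using that P_minus[OF that] by (metis P.minus_closed)
  have rel: "?L x = \<zero>" if x: "x \<in> tensor_rels C \<beta> \<alpha> B A" for x
  proof -
    have z: "(u \<oplus> v) \<ominus> u \<ominus> v = \<zero>" if "u \<in> carrier R" "v \<in> carrier R" for u v
      using that by algebra
    from x show ?thesis
    proof (cases rule: tensor_rels_cases)
      case 1 then show ?thesis
        by (simp add: Ld Lf dc frag_closed gc hc ring_hom_add[OF g] R.l_distr z)
    next
      case 2 then show ?thesis
        by (simp add: Ld Lf dc frag_closed gc hc ring_hom_add[OF h] R.r_distr z)
    next
      case 3 then show ?thesis
        by (simp add: Ld Lf dc frag_closed gc hc bc ring_hom_mult[OF h] ring_hom_mult[OF g] eq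
            R.m_assoc R.minus_eq R.r_neg)
    qed
  qed
  have J: "J \<subseteq> a_kernel P R ?L"
    unfolding tensor_ideal_def
  proof (rule P.genideal_minimal[OF L.kernel_is_ideal], rule subsetI)
    fix x assume "x \<in> tensor_rels C \<beta> \<alpha> B A"
    then show "x \<in> a_kernel P R ?L"
      unfolding a_kernel_def' using rel subsetD[OF rels_closed] by blast
  qed
  have *: "copair R g h (J +>\<^bsub>P\<^esub> x) = ?L x" if x: "x \<in> carrier P" for x
  proof -
    have "?L y = ?L x" if "y \<in> J +>\<^bsub>P\<^esub> x" for y
    proof -
      from that have "y \<in> a_kernel P R ?L +>\<^bsub>P\<^esub> x" using J by (auto simp: a_r_coset_def')
      then show ?thesis by (rule L.rcos_imp_homeq[OF x])
    qed
    moreover have "x \<in> J +>\<^bsub>P\<^esub> x" using x by (rule J.a_rcos_self)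
    ultimately have "?L ` (J +>\<^bsub>P\<^esub> x) = {?L x}" by blast
    then show ?thesis by (simp add: copair_def)
  qed
  show "copair R g h (pt b a) = g b \<otimes> h a" if "b \<in> carrier B" "a \<in> carrier A" for b a
    using that unfolding pure_tensor_def by (simp add: * frag_closed Lf)
  show "copair R g h \<in> ring_hom T R"
  proof (rule ring_hom_memI)
    fix Z assume "Z \<in> carrier T"
    then obtain x where x: "x \<in> carrier P" "Z = J +>\<^bsub>P\<^esub> x" using carrier_T by blast
    then show "copair R g h Z \<in> carrier R" by (simp add: *)
    fix Y assume "Y \<in> carrier T"
    then obtain y where y: "y \<in> carrier P" "Y = J +>\<^bsub>P\<^esub> y" using carrier_T by blast
    show "copair R g h (Z \<otimes>\<^bsub>T\<^esub> Y) = copair R g h Z \<otimes> copair R g h Y"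
      unfolding x(2) y(2) ring_hom_mult[OF proj_hom x(1) y(1), symmetric] using x y
      by (simp add: * del: J.a_rcos_sum)
    show "copair R g h (Z \<oplus>\<^bsub>T\<^esub> Y) = copair R g h Z \<oplus> copair R g h Y"
      unfolding x(2) y(2) ring_hom_add[OF proj_hom x(1) y(1), symmetric] using x y
      by (simp add: *)
  next
    show "copair R g h \<one>\<^bsub>T\<^esub> = \<one>"
      unfolding ring_hom_one[OF proj_hom, symmetric] by (simp add: *)
  qed
qed

lemma hom_eqI:
  fixes R (structure)
  assumes R: "ring R" and k: "k \<in> ring_hom T R" and l: "l \<in> ring_hom T R"
    and eq: "\<And>b a. b \<in> carrier B \<Longrightarrow> a \<in> carrier A \<Longrightarrow> k (pt b a) = l (pt b a)"
    and Z: "Z \<in> carrier T"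
  shows "k Z = l Z"
proof -
  interpret R: ring R by fact
  let ?S = "carrier B \<times> carrier A"
  have *: "m (J +>\<^bsub>P\<^esub> x) = lin_ext R (\<lambda>p. m (J +>\<^bsub>P\<^esub> (frag_of p))) x"
    if m: "m \<in> ring_hom T R" and x: "x \<in> carrier P" for m x
  proof (rule additive_eq_lin_ext[of R ?S "\<lambda>x. m (J +>\<^bsub>P\<^esub> x)"])
    fix c :: "'b \<times> 'a \<Rightarrow>\<^sub>0 int" assume c: "Poly_Mapping.keys c \<subseteq> ?S"
    then have "c \<in> carrier P" by (simp add: pair_ring_simps)
    then show "m (J +>\<^bsub>P\<^esub> c) \<in> carrier R"
      by (intro ring_hom_closed[OF m] ring_hom_closed[OF proj_hom])
    fix d :: "'b \<times> 'a \<Rightarrow>\<^sub>0 int" assume d: "Poly_Mapping.keys d \<subseteq> ?S"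
    have cd: "c \<in> carrier P" "d \<in> carrier P" using c d by (auto simp: pair_ring_simps)
    then show "m (J +>\<^bsub>P\<^esub> (c + d)) = m (J +>\<^bsub>P\<^esub> c) \<oplus> m (J +>\<^bsub>P\<^esub> d)"
      using ring_hom_add[OF proj_hom cd]
        ring_hom_add[OF m ring_hom_closed[OF proj_hom cd(1)] ring_hom_closed[OF proj_hom cd(2)]]
      by (simp add: pair_ring_simps(5))
  qed (use x R in \<open>simp_all add: pair_ring_simps\<close>)
  obtain x where x: "x \<in> carrier P" "Z = J +>\<^bsub>P\<^esub> x" using Z carrier_T by blast
  have "(\<lambda>p. k (J +>\<^bsub>P\<^esub> (frag_of p))) p = (\<lambda>p. l (J +>\<^bsub>P\<^esub> (frag_of p))) p" if "p \<in> Poly_Mapping.keys x" for p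
    using that x eq[of "fst p" "snd p"] by (auto simp: pair_ring_simps pure_tensor_def)
  then have "lin_ext R (\<lambda>p. k (J +>\<^bsub>P\<^esub> (frag_of p))) x = lin_ext R (\<lambda>p. l (J +>\<^bsub>P\<^esub> (frag_of p))) x"
    using x ring_hom_closed[OF l pt_closed] unfolding lin_ext_def
    by (intro R.finsum_cong') (auto simp: pair_ring_simps pure_tensor_def)
  then show ?thesis using *[OF k x(1)] *[OF l x(1)] x by simp
qed

end

lemma poly_ring_simps [simp]:
  "carrier poly_ring = UNIV" "p \<otimes>\<^bsub>poly_ring\<^esub> q = p * q" "p \<oplus>\<^bsub>poly_ring\<^esub> q = p + q"
  "\<one>\<^bsub>poly_ring\<^esub> = 1" "\<zero>\<^bsub>poly_ring\<^esub> = 0"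
  by (simp_all add: ring_of_type_algebra_def)

lemma poly_ring_cring: "cring (poly_ring :: 'v poly_int ring)"
  by (rule cring_from_type_algebra)

lemma one_poly: "(1 :: 'v poly_int) = frag_of 0"
  by simp

lemma
  fixes R (structure)
  assumes R: "cring R" and \<rho>: "\<And>v. \<rho> v \<in> carrier R"
  shows poly_eval_hom: "poly_eval R \<rho> \<in> ring_hom poly_ring R"
    and poly_eval_pvar: "poly_eval R \<rho> (pvar v) = \<rho> v"
proof -
  interpret R: cring R by fact
  define mon where "mon = (\<lambda>m. \<Otimes>v\<in>Poly_Mapping.keys m. \<rho> v [^] (Poly_Mapping.lookup m v :: nat))"
  have ev: "poly_eval R \<rho> = lin_ext R mon" by (simp add: poly_eval_def mon_def)
  have mc: "mon m \<in> carrier R" for m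
    unfolding mon_def using \<rho> by (auto intro: R.finprod_closed)
  have ms: "mon m = (\<Otimes>v\<in>K. \<rho> v [^] (Poly_Mapping.lookup m v))"
    if "finite K" "Poly_Mapping.keys m \<subseteq> K" for m K
    unfolding mon_def
    by (rule R.finprod_mono_neutral_cong_left) (use that \<rho> in \<open>auto simp: in_keys_iff\<close>)
  have mm: "mon (m + m') = mon m \<otimes> mon m'" for m m'
  proof -
    let ?K = "Poly_Mapping.keys m \<union> Poly_Mapping.keys m'"
    have "mon (m + m') = (\<Otimes>v\<in>?K. \<rho> v [^] (Poly_Mapping.lookup (m + m') v))"
      by (rule ms) (use Poly_Mapping.keys_add[of m m'] in auto)
    also have "\<dots> = (\<Otimes>v\<in>?K. \<rho> v [^] (Poly_Mapping.lookup m v) \<otimes> \<rho> v [^] (Poly_Mapping.lookup m' v))"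
      by (rule R.finprod_cong') (use \<rho> in \<open>auto simp: lookup_add R.nat_pow_mult\<close>)
    also have "\<dots> = mon m \<otimes> mon m'"
      by (subst (1 2) ms[of ?K]) (use \<rho> in \<open>auto simp: R.finprod_multf\<close>)
    finally show ?thesis .
  qed
  have cl: "lin_ext R mon c \<in> carrier R" for c using mc by auto
  have of: "lin_ext R mon (frag_of m) = mon m" for m using mc by simp
  have diff: "lin_ext R mon (c - d) = lin_ext R mon c \<ominus> lin_ext R mon d" for c d
    by (rule R.lin_ext_diff[of _ UNIV]) (use mc in auto)
  have mult: "lin_ext R mon (c * d) = lin_ext R mon c \<otimes> lin_ext R mon d" for c d
    using subset_UNIV
  proof (induction c rule: frag_induction)
    case zero then show ?case using cl by simp
  next
    case (one x)
    show ?case using subset_UNIV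
    proof (induction d rule: frag_induction)
      case zero then show ?case using cl by simp
    next
      case (one y) then show ?case by (simp add: mult_single of mm)
    next
      case (diff a b) then show ?case
        using cl by (simp add: right_diff_distrib \<open>\<And>c d. lin_ext R mon (c - d) = _\<close> R.r_distr R.minus_eq R.r_minus)
    qed
  next
    case (diff a b) then show ?case
      using cl by (simp add: left_diff_distrib \<open>\<And>c d. lin_ext R mon (c - d) = _\<close> R.l_distr R.minus_eq R.l_minus)
  qed
  have m0: "mon 0 = \<one>" by (simp add: mon_def)
  show "poly_eval R \<rho> \<in> ring_hom poly_ring R"
  proof (rule ring_hom_memI)
    show "poly_eval R \<rho> \<one>\<^bsub>poly_ring\<^esub> = \<one>"
      using of[of 0] by (simp add: ev m0)
    fix p q
    show "poly_eval R \<rho> (p \<oplus>\<^bsub>poly_ring\<^esub> q) = poly_eval R \<rho> p \<oplus> poly_eval R \<rho> q"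
      using R.lin_ext_add[of p UNIV q mon] mc by (simp add: ev)
  qed (auto simp: ev cl mult)
  show "poly_eval R \<rho> (pvar v) = \<rho> v"
    unfolding ev pvar_def of using \<rho> by (simp add: mon_def)
qed

lemma poly_hom_eqI:
  fixes R (structure)
  assumes R: "cring R" and k: "k \<in> ring_hom poly_ring R" and l: "l \<in> ring_hom poly_ring R"
    and eq: "\<And>v. k (pvar v) = l (pvar v)"
  shows "k p = l p"
proof -
  interpret R: cring R by fact
  have kl_mult: "k (frag_of (m + m')) = l (frag_of (m + m'))"
    if "k (frag_of m) = l (frag_of m)" "k (frag_of m') = l (frag_of m')" for m m'
    using that ring_hom_mult[OF k, of "frag_of m" "frag_of m'"]
      ring_hom_mult[OF l, of "frag_of m" "frag_of m'"] by (simp add: mult_single)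
  have kl_0: "k (frag_of 0) = l (frag_of 0)"
    using ring_hom_one[OF k] ring_hom_one[OF l] by simp
  have kl_single: "k (frag_of (Poly_Mapping.single v n)) = l (frag_of (Poly_Mapping.single v n))" for v n
  proof (induction n)
    case 0 then show ?case using kl_0 by simp
  next
    case (Suc n)
    have "Poly_Mapping.single v (Suc n) = Poly_Mapping.single v n + Poly_Mapping.single v 1"
      by (simp add: single_add[symmetric])
    then show ?case using kl_mult Suc eq[of v] by (simp only: pvar_def)
  qed
  have kl: "k (frag_of m) = l (frag_of m)" for m
  proof -
    have "k (frag_of (\<Sum>v\<in>K. Poly_Mapping.single v (Poly_Mapping.lookup m v))) =
          l (frag_of (\<Sum>v\<in>K. Poly_Mapping.single v (Poly_Mapping.lookup m v)))"
      if "finite K" for K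
      using that by (induction K rule: finite_induct) (use kl_0 kl_mult kl_single in auto)
    moreover have "m = (\<Sum>v\<in>Poly_Mapping.keys m. Poly_Mapping.single v (Poly_Mapping.lookup m v))"
      by (rule poly_mapping_eqI)
        (auto simp: lookup_sum lookup_single when_def in_keys_iff)
    ultimately show ?thesis by (metis finite_keys)
  qed
  have *: "m p = lin_ext R (\<lambda>x. m (frag_of x)) p" if "m \<in> ring_hom poly_ring R" for m
    by (rule additive_eq_lin_ext[of R UNIV])
      (use that ring_hom_closed[OF that] ring_hom_add[OF that] R.ring_axioms in auto)
  show ?thesis using *[OF k] *[OF l] kl by simp
qed

lemma (in abelian_monoid) finsum_swap:
  assumes "finite I" "finite J" "\<And>i j. i \<in> I \<Longrightarrow> j \<in> J \<Longrightarrow> f i j \<in> carrier G"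
  shows "(\<Oplus>i\<in>I. \<Oplus>j\<in>J. f i j) = (\<Oplus>j\<in>J. \<Oplus>i\<in>I. f i j)"
  using assms(1,3)
proof (induction I rule: finite_induct)
  case empty then show ?case by simp
next
  case (insert x I)
  then have c: "\<And>i j. i \<in> I \<Longrightarrow> j \<in> J \<Longrightarrow> f i j \<in> carrier G"
    "\<And>j. j \<in> J \<Longrightarrow> f x j \<in> carrier G" by auto
  have "(\<Oplus>j\<in>J. \<Oplus>i\<in>insert x I. f i j) = (\<Oplus>j\<in>J. f x j \<oplus> (\<Oplus>i\<in>I. f i j))"
    by (rule finsum_cong') (use insert c in \<open>auto intro!: finsum_closed\<close>)
  also have "\<dots> = (\<Oplus>j\<in>J. f x j) \<oplus> (\<Oplus>j\<in>J. \<Oplus>i\<in>I. f i j)"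
    by (rule finsum_addf) (use c in \<open>auto intro!: finsum_closed\<close>)
  also have "(\<Oplus>j\<in>J. \<Oplus>i\<in>I. f i j) = (\<Oplus>i\<in>I. \<Oplus>j\<in>J. f i j)"
    using insert c by simp
  finally show ?case using insert c by (subst finsum_insert) (auto intro!: finsum_closed)
qed

lemma mat_monoid: 
  assumes "cring R"
  shows "monoid (mat_monoid R :: ('n::finite \<Rightarrow> 'n \<Rightarrow> 'r) monoid)"
proof -
  interpret R: cring R by fact
  show ?thesis
  proof (rule monoidI)
    fix M N K :: "'n \<Rightarrow> 'n \<Rightarrow> 'r"
    assume "M \<in> carrier (mat_monoid R)" "N \<in> carrier (mat_monoid R)"
    then have c: "\<And>i j. M i j \<in> carrier R" "\<And>i j. N i j \<in> carrier R"
      by (auto simp: mat_monoid_def)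
    then show "M \<otimes>\<^bsub>mat_monoid R\<^esub> N \<in> carrier (mat_monoid R)"
      by (auto simp: mat_monoid_def intro!: R.finsum_closed)
    assume "K \<in> carrier (mat_monoid R)"
    then have c': "\<And>i j. K i j \<in> carrier R" by (auto simp: mat_monoid_def)
    have "(\<Oplus>\<^bsub>R\<^esub>k\<in>UNIV. (\<Oplus>\<^bsub>R\<^esub>l\<in>UNIV. M i l \<otimes>\<^bsub>R\<^esub> N l k) \<otimes>\<^bsub>R\<^esub> K k j) =
          (\<Oplus>\<^bsub>R\<^esub>l\<in>UNIV. M i l \<otimes>\<^bsub>R\<^esub> (\<Oplus>\<^bsub>R\<^esub>k\<in>UNIV. N l k \<otimes>\<^bsub>R\<^esub> K k j))" for i j
    proof -
      have "(\<Oplus>\<^bsub>R\<^esub>k\<in>UNIV. (\<Oplus>\<^bsub>R\<^esub>l\<in>UNIV. M i l \<otimes>\<^bsub>R\<^esub> N l k) \<otimes>\<^bsub>R\<^esub> K k j) =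
            (\<Oplus>\<^bsub>R\<^esub>k\<in>UNIV. \<Oplus>\<^bsub>R\<^esub>l\<in>UNIV. M i l \<otimes>\<^bsub>R\<^esub> (N l k \<otimes>\<^bsub>R\<^esub> K k j))"
        using c c' by (intro R.finsum_cong') (auto simp: R.finsum_ldistr R.m_assoc intro!: R.finsum_closed)
      also have "\<dots> = (\<Oplus>\<^bsub>R\<^esub>l\<in>UNIV. \<Oplus>\<^bsub>R\<^esub>k\<in>UNIV. M i l \<otimes>\<^bsub>R\<^esub> (N l k \<otimes>\<^bsub>R\<^esub> K k j))"
        using c c' by (intro R.finsum_swap) auto
      also have "\<dots> = (\<Oplus>\<^bsub>R\<^esub>l\<in>UNIV. M i l \<otimes>\<^bsub>R\<^esub> (\<Oplus>\<^bsub>R\<^esub>k\<in>UNIV. N l k \<otimes>\<^bsub>R\<^esub> K k j))"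
        using c c' by (intro R.finsum_cong') (auto simp: R.finsum_rdistr intro!: R.finsum_closed)
      finally show ?thesis .
    qed
    then show "M \<otimes>\<^bsub>mat_monoid R\<^esub> N \<otimes>\<^bsub>mat_monoid R\<^esub> K = M \<otimes>\<^bsub>mat_monoid R\<^esub> (N \<otimes>\<^bsub>mat_monoid R\<^esub> K)"
      by (simp add: mat_monoid_def)
  next
    fix M :: "'n \<Rightarrow> 'n \<Rightarrow> 'r"
    assume "M \<in> carrier (mat_monoid R)"
    then have c: "\<And>i j. M i j \<in> carrier R" by (auto simp: mat_monoid_def)
    have "(\<Oplus>\<^bsub>R\<^esub>k\<in>UNIV. (if i = k then \<one>\<^bsub>R\<^esub> else \<zero>\<^bsub>R\<^esub>) \<otimes>\<^bsub>R\<^esub> M k j) = M i j" for i j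
    proof -
      have "(\<Oplus>\<^bsub>R\<^esub>k\<in>UNIV. (if i = k then \<one>\<^bsub>R\<^esub> else \<zero>\<^bsub>R\<^esub>) \<otimes>\<^bsub>R\<^esub> M k j) =
          (\<Oplus>\<^bsub>R\<^esub>k\<in>UNIV. (if i = k then M k j else \<zero>\<^bsub>R\<^esub>))"
        using c by (intro R.finsum_cong') auto
      then show ?thesis using R.finsum_singleton[of i UNIV "\<lambda>k. M k j"] c by simp
    qed
    then show "\<one>\<^bsub>mat_monoid R\<^esub> \<otimes>\<^bsub>mat_monoid R\<^esub> M = M" by (simp add: mat_monoid_def)
    have "(\<Oplus>\<^bsub>R\<^esub>k\<in>UNIV. M i k \<otimes>\<^bsub>R\<^esub> (if k = j then \<one>\<^bsub>R\<^esub> else \<zero>\<^bsub>R\<^esub>)) = M i j" for i j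
    proof -
      have "(\<Oplus>\<^bsub>R\<^esub>k\<in>UNIV. M i k \<otimes>\<^bsub>R\<^esub> (if k = j then \<one>\<^bsub>R\<^esub> else \<zero>\<^bsub>R\<^esub>)) =
          (\<Oplus>\<^bsub>R\<^esub>k\<in>UNIV. (if j = k then M i k else \<zero>\<^bsub>R\<^esub>))"
        using c by (intro R.finsum_cong') auto
      then show ?thesis using R.finsum_singleton[of j UNIV "\<lambda>k. M i k"] c by simp
    qed
    then show "M \<otimes>\<^bsub>mat_monoid R\<^esub> \<one>\<^bsub>mat_monoid R\<^esub> = M" by (simp add: mat_monoid_def)
  qed (auto simp: mat_monoid_def)
qed

lemma GL_group: "cring R \<Longrightarrow> group (GL R)"
  unfolding GL_def by (rule monoid.units_group[OF mat_monoid])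

lemma int_map_hom:
  assumes "ring R" shows "int_map R \<in> ring_hom \<Z> R"
proof -
  interpret ring R by fact
  show ?thesis
  proof (rule ring_hom_memI)
    fix k l :: int
    show "int_map R (k \<otimes>\<^bsub>\<Z>\<^esub> l) = int_map R k \<otimes>\<^bsub>R\<^esub> int_map R l"
      using add_pow_ldistr_int[of "\<one>\<^bsub>R\<^esub>" "int_map R l" k] add.int_pow_pow[of "\<one>\<^bsub>R\<^esub>" k l]
      by (simp add: int_map_def mult.commute)
    show "int_map R (k \<oplus>\<^bsub>\<Z>\<^esub> l) = int_map R k \<oplus>\<^bsub>R\<^esub> int_map R l"
      by (simp add: int_map_def add.int_pow_mult)
  qed (auto simp: int_map_def)
qed

lemma ring_hom_int_map:
  assumes "ring R" "ring S" "h \<in> ring_hom R S"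
  shows "h (int_map R k) = int_map S k"
proof -
  interpret h: ring_hom_ring R S h by (rule ring_hom_ringI2) fact+
  have "group_hom (add_monoid R) (add_monoid S) h" by (rule h.a_group_hom)
  from group_hom.hom_int_pow[OF this, of "\<one>\<^bsub>R\<^esub>" k] show ?thesis
    by (simp add: int_map_def add_pow_def)
qed

lemma tensor_dataZ:
  assumes "cring B" "cring A"
  shows "tensor_data B A \<Z> (int_map B) (int_map A)"
proof -
  interpret B: cring B by fact
  interpret A: cring A by fact
  show ?thesis
    by unfold_locales (auto simp: int_map_def)
qed

lemma ring_hom_cong:
  assumes R: "ring R" and h: "h \<in> ring_hom R S" and eq: "\<And>x. x \<in> carrier R \<Longrightarrow> h x = g x"
  shows "g \<in> ring_hom R S"
proof -
  interpret ring R by fact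
  show ?thesis
    by (rule ring_hom_memI)
      (use ring_hom_closed[OF h] ring_hom_mult[OF h] ring_hom_add[OF h] ring_hom_one[OF h] in
        \<open>auto simp: eq[symmetric]\<close>)
qed

locale gscheme =
  fixes G :: "'a group_scheme"
  assumes gs: "affine_group_scheme G"
begin

abbreviation "A \<equiv> coord_ring G"
abbreviation "\<Delta> \<equiv> comult G"
abbreviation "\<epsilon> \<equiv> counit G"
abbreviation "S \<equiv> antipode G"
abbreviation "A2 \<equiv> tensorZ A A"
abbreviation "A3 \<equiv> tensorZ A A2"
abbreviation "j1 \<equiv> (\<lambda>a. pureZ A A2 a \<one>\<^bsub>A2\<^esub>)"
abbreviation "j2 \<equiv> (\<lambda>a. pureZ A A2 \<one>\<^bsub>A\<^esub> (pureZ A A a \<one>\<^bsub>A\<^esub>))"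
abbreviation "j3 \<equiv> (\<lambda>a. pureZ A A2 \<one>\<^bsub>A\<^esub> (pureZ A A \<one>\<^bsub>A\<^esub> a))"

lemma gsD:
  "cring A" "\<Delta> \<in> ring_hom A A2" "\<epsilon> \<in> ring_hom A \<Z>" "S \<in> ring_hom A A"
  "a \<in> carrier A \<Longrightarrow>
     copair A3 (copair A3 j1 j2 \<circ> \<Delta>) j3 (\<Delta> a) = copair A3 j1 (copair A3 j2 j3 \<circ> \<Delta>) (\<Delta> a)"
  "a \<in> carrier A \<Longrightarrow> copair A (int_map A \<circ> \<epsilon>) id (\<Delta> a) = a"
  "a \<in> carrier A \<Longrightarrow> copair A id (int_map A \<circ> \<epsilon>) (\<Delta> a) = a"
  "a \<in> carrier A \<Longrightarrow> copair A S id (\<Delta> a) = int_map A (\<epsilon> a)"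
  "a \<in> carrier A \<Longrightarrow> copair A id S (\<Delta> a) = int_map A (\<epsilon> a)"
  using gs unfolding affine_group_scheme_def Let_def by blast+

sublocale A: cring A by (rule gsD(1))
sublocale T2: tensor_data A A \<Z> "int_map A" "int_map A"
  by (rule tensor_dataZ) (rule gsD(1))+
sublocale T3: tensor_data A A2 \<Z> "int_map A" "int_map A2"
  by (rule tensor_dataZ) (rule gsD(1) T2.T.is_cring)+

lemma Delta_closed [intro, simp]: "a \<in> carrier A \<Longrightarrow> \<Delta> a \<in> carrier A2"
  by (rule ring_hom_closed[OF gsD(2)])

lemma agree:
  assumes "cring R" "cring B" "cring C" "g \<in> ring_hom B R" "h \<in> ring_hom C R"
  shows "g (int_map B k) = h (int_map C k)"
  using ring_hom_int_map[of B R g k] ring_hom_int_map[of C R h k] assms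
  by (simp add: cring.axioms(1))

lemma
  assumes R: "cring R" and g: "g \<in> ring_hom A R" and h: "h \<in> ring_hom A R"
  shows cp2_hom: "copair R g h \<in> ring_hom A2 R"
    and cp2_pt: "a \<in> carrier A \<Longrightarrow> b \<in> carrier A \<Longrightarrow> copair R g h (pureZ A A a b) = g a \<otimes>\<^bsub>R\<^esub> h b"
  by (rule T2.copair_hom[OF R g h agree[OF R gsD(1) gsD(1) g h]])
    (rule T2.copair_pt[OF R g h agree[OF R gsD(1) gsD(1) g h]])

lemma
  assumes R: "cring R" and g: "g \<in> ring_hom A R" and h: "h \<in> ring_hom A2 R"
  shows cp3_hom: "copair R g h \<in> ring_hom A3 R"
    and cp3_pt: "a \<in> carrier A \<Longrightarrow> b \<in> carrier A2 \<Longrightarrow> copair R g h (pureZ A A2 a b) = g a \<otimes>\<^bsub>R\<^esub> h b"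
  by (rule T3.copair_hom[OF R g h agree[OF R gsD(1) T2.T.is_cring g h]])
    (rule T3.copair_pt[OF R g h agree[OF R gsD(1) T2.T.is_cring g h]])

lemma cp2_nat:
  assumes R: "cring R" and R': "cring R'" and g: "g \<in> ring_hom A R" and h: "h \<in> ring_hom A R"
    and \<theta>: "\<theta> \<in> ring_hom R R'"
    and g': "\<And>a. a \<in> carrier A \<Longrightarrow> g' a = \<theta> (g a)"
    and h': "\<And>a. a \<in> carrier A \<Longrightarrow> h' a = \<theta> (h a)"
    and Z: "Z \<in> carrier A2"
  shows "\<theta> (copair R g h Z) = copair R' g' h' Z"
proof -
  have gt: "g' \<in> ring_hom A R'"
    by (rule ring_hom_cong[OF A.ring_axioms ring_hom_trans[OF g \<theta>]]) (simp add: g')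
  have ht: "h' \<in> ring_hom A R'"
    by (rule ring_hom_cong[OF A.ring_axioms ring_hom_trans[OF h \<theta>]]) (simp add: h')
  have "(\<theta> \<circ> copair R g h) Z = copair R' g' h' Z"
  proof (rule T2.hom_eqI[OF _ _ _ _ Z])
    show "ring R'" using R' by (rule cring.axioms(1))
    show "\<theta> \<circ> copair R g h \<in> ring_hom A2 R'"
      by (rule ring_hom_trans[OF cp2_hom[OF R g h] \<theta>])
    show "copair R' g' h' \<in> ring_hom A2 R'" by (rule cp2_hom[OF R' gt ht])
  qed (simp add: cp2_pt[OF R g h] cp2_pt[OF R' gt ht] ring_hom_mult[OF \<theta>]
      ring_hom_closed[OF g] ring_hom_closed[OF h] g' h')
  then show ?thesis by simp
qed

lemma comp_Delta: "cring R \<Longrightarrow> g \<in> ring_hom A R \<Longrightarrow> h \<in> ring_hom A R \<Longrightarrow>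
    (\<lambda>a. copair R g h (\<Delta> a)) \<in> ring_hom A R"
  using ring_hom_trans[OF gsD(2) cp2_hom, of R g h] by (simp only: comp_def)

lemma counit_hom: "ring R \<Longrightarrow> (\<lambda>a. int_map R (\<epsilon> a)) \<in> ring_hom A R"
  using ring_hom_trans[OF gsD(3) int_map_hom, of R] by (simp only: comp_def)

lemma points_simps:
  "g \<in> carrier (points G R) \<longleftrightarrow> g \<in> ring_hom A R \<and> g \<in> extensional (carrier A)"
  "g \<otimes>\<^bsub>points G R\<^esub> h = (\<lambda>a\<in>carrier A. copair R g h (\<Delta> a))"
  "\<one>\<^bsub>points G R\<^esub> = (\<lambda>a\<in>carrier A. int_map R (\<epsilon> a))"
  by (auto simp: points_def)

lemma restrict_hom: "g \<in> ring_hom A R \<Longrightarrow> restrict g (carrier A) \<in> ring_hom A R"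
  by (rule ring_hom_cong[OF A.ring_axioms]) auto

lemma j_hom: "j1 \<in> ring_hom A A3" "j2 \<in> ring_hom A A3" "j3 \<in> ring_hom A A3"
  using T3.inL_hom ring_hom_trans[OF T2.inL_hom T3.inR_hom] ring_hom_trans[OF T2.inR_hom T3.inR_hom]
  by (simp_all only: comp_def)

text \<open>The Hopf algebra axioms are stated for the universal points only; \<open>G(R)\<close> is then a group
  for every commutative ring \<open>R\<close>, of any type.\<close>

theorem points_group:
  assumes R: "cring R"
  shows "group (points G R)"
proof -
  interpret R: cring R by fact
  note [simp] = points_simps
  note rr = restrict_hom
  note ch = comp_Delta[OF R]
  show ?thesis
  proof (rule groupI)
    fix g h k assume "g \<in> carrier (points G R)" "h \<in> carrier (points G R)" "k \<in> carrier (points G R)"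
    then have g: "g \<in> ring_hom A R" and h: "h \<in> ring_hom A R" and k: "k \<in> ring_hom A R" by auto
    define \<Psi> where "\<Psi> = copair R g (copair R h k)"
    have \<Psi>: "\<Psi> \<in> ring_hom A3 R"
      unfolding \<Psi>_def by (rule cp3_hom[OF R g cp2_hom[OF R h k]])
    have \<Psi>j: "\<Psi> (j1 a) = g a" "\<Psi> (j2 a) = h a" "\<Psi> (j3 a) = k a" if "a \<in> carrier A" for a
      using that ring_hom_closed[OF g] ring_hom_closed[OF h] ring_hom_closed[OF k]
      by (simp_all add: \<Psi>_def cp3_pt[OF R g cp2_hom[OF R h k]] cp2_pt[OF R h k]
          ring_hom_one[OF g] ring_hom_one[OF h] ring_hom_one[OF k] ring_hom_one[OF cp2_hom[OF R h k]])
    note nat = cp2_nat[OF T3.T.is_cring R _ _ \<Psi>]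
    have n12: "\<Psi> (copair A3 j1 j2 Z) = copair R g h Z" if "Z \<in> carrier A2" for Z
      by (rule nat[OF j_hom(1,2) _ _ that]) (simp_all add: \<Psi>j)
    have n23: "\<Psi> (copair A3 j2 j3 Z) = copair R h k Z" if "Z \<in> carrier A2" for Z
      by (rule nat[OF j_hom(2,3) _ _ that]) (simp_all add: \<Psi>j)
    have c12: "copair A3 j1 j2 \<circ> \<Delta> \<in> ring_hom A A3"
      by (rule ring_hom_trans[OF gsD(2) cp2_hom[OF T3.T.is_cring j_hom(1,2)]])
    have c23: "copair A3 j2 j3 \<circ> \<Delta> \<in> ring_hom A A3"
      by (rule ring_hom_trans[OF gsD(2) cp2_hom[OF T3.T.is_cring j_hom(2,3)]])
    have "copair R (\<lambda>a\<in>carrier A. copair R g h (\<Delta> a)) k (\<Delta> a) =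
          copair R g (\<lambda>a\<in>carrier A. copair R h k (\<Delta> a)) (\<Delta> a)" if a: "a \<in> carrier A" for a
    proof -
      have "copair R (\<lambda>a\<in>carrier A. copair R g h (\<Delta> a)) k (\<Delta> a) =
            \<Psi> (copair A3 (copair A3 j1 j2 \<circ> \<Delta>) j3 (\<Delta> a))"
        by (rule nat[OF c12 j_hom(3), symmetric]) (use a in \<open>simp_all add: \<Psi>j n12\<close>)
      also have "\<dots> = \<Psi> (copair A3 j1 (copair A3 j2 j3 \<circ> \<Delta>) (\<Delta> a))"
        by (simp add: gsD(5)[OF a])
      also have "\<dots> = copair R g (\<lambda>a\<in>carrier A. copair R h k (\<Delta> a)) (\<Delta> a)"
        by (rule nat[OF j_hom(1) c23]) (use a in \<open>simp_all add: \<Psi>j n23\<close>)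
      finally show ?thesis .
    qed
    then show "g \<otimes>\<^bsub>points G R\<^esub> h \<otimes>\<^bsub>points G R\<^esub> k = g \<otimes>\<^bsub>points G R\<^esub> (h \<otimes>\<^bsub>points G R\<^esub> k)"
      by (auto simp: restrict_def)
    show "g \<otimes>\<^bsub>points G R\<^esub> h \<in> carrier (points G R)"
      using rr[OF ch[OF g h]] by simp
  next
    show "\<one>\<^bsub>points G R\<^esub> \<in> carrier (points G R)"
      using rr[OF counit_hom[OF R.ring_axioms]] by simp
  next
    fix g assume "g \<in> carrier (points G R)"
    then have g: "g \<in> ring_hom A R" and ge: "g \<in> extensional (carrier A)" by auto
    have ig: "g (int_map A m) = int_map R m" for m
      by (rule ring_hom_int_map[OF A.ring_axioms R.ring_axioms g])
    have id: "id \<in> ring_hom A A" by (simp add: ring_hom_def)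
    have e: "int_map A \<circ> \<epsilon> \<in> ring_hom A A"
      using counit_hom[OF A.ring_axioms] by (simp add: comp_def)
    have "copair R (\<lambda>a\<in>carrier A. int_map R (\<epsilon> a)) g (\<Delta> a) = g a" if a: "a \<in> carrier A" for a
      using cp2_nat[OF A.is_cring R e id g, of "\<lambda>a\<in>carrier A. int_map R (\<epsilon> a)" g "\<Delta> a"] a
      by (simp add: gsD(6) ig)
    then show "\<one>\<^bsub>points G R\<^esub> \<otimes>\<^bsub>points G R\<^esub> g = g"
      using ge by (auto simp: fun_eq_iff restrict_def extensional_def)
    have sh: "restrict (g \<circ> S) (carrier A) \<in> ring_hom A R"
      by (rule rr[OF ring_hom_trans[OF gsD(4) g]])
    have "copair R (restrict (g \<circ> S) (carrier A)) g (\<Delta> a) = int_map R (\<epsilon> a)" if a: "a \<in> carrier A" for a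
      using cp2_nat[OF A.is_cring R gsD(4) id g, of "restrict (g \<circ> S) (carrier A)" g "\<Delta> a"] a
      by (simp add: gsD(8) ig)
    then have "restrict (g \<circ> S) (carrier A) \<otimes>\<^bsub>points G R\<^esub> g = \<one>\<^bsub>points G R\<^esub>"
      by (auto simp: fun_eq_iff restrict_def)
    then show "\<exists>h\<in>carrier (points G R). h \<otimes>\<^bsub>points G R\<^esub> g = \<one>\<^bsub>points G R\<^esub>"
      using sh by (intro bexI[of _ "restrict (g \<circ> S) (carrier A)"]) simp_all
  qed
qed

lemma rep_hom: "representation G \<pi> \<Longrightarrow> \<pi> \<in> ring_hom poly_ring A"
  by (simp add: representation_def)

lemma rep_closed: "representation G \<pi> \<Longrightarrow> \<pi> p \<in> carrier A"
  using ring_hom_closed[OF rep_hom, of \<pi> p] by simp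

lemma GL_simps:
  "M \<otimes>\<^bsub>GL R\<^esub> N = (\<lambda>i j. \<Oplus>\<^bsub>R\<^esub>k\<in>UNIV. M i k \<otimes>\<^bsub>R\<^esub> N k j)"
  "\<one>\<^bsub>GL R\<^esub> = (\<lambda>i j. if i = j then \<one>\<^bsub>R\<^esub> else \<zero>\<^bsub>R\<^esub>)"
  by (simp_all add: GL_def units_of_def mat_monoid_def)

theorem representation_all:
  fixes \<pi> :: "('n::finite \<times> 'n) poly_int \<Rightarrow> 'a" and R :: "('r, 'm) ring_scheme"
  assumes rep: "representation G \<pi>" and R: "cring R"
  shows "rep_matrix \<pi> \<in> hom (points G R) (GL R)"
proof -
  interpret R: cring R by fact
  interpret pR: Group.group "points G R" by (rule points_group[OF R])
  interpret pT: Group.group "points G A2" by (rule points_group[OF T2.T.is_cring])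
  let ?x = "\<lambda>i j. \<pi> (pvar (i, j))"
  have x: "?x i j \<in> carrier A" for i j by (rule rep_closed[OF rep])
  have repT: "rep_matrix \<pi> \<in> hom (points G A2) (GL A2)"
    using rep T2.T.is_cring by (simp add: representation_def)
  have mult: "rep_matrix \<pi> (g \<otimes>\<^bsub>points G R\<^esub> h) = rep_matrix \<pi> g \<otimes>\<^bsub>GL R\<^esub> rep_matrix \<pi> h"
    if "g \<in> carrier (points G R)" "h \<in> carrier (points G R)" for g h
  proof -
    have g: "g \<in> ring_hom A R" and h: "h \<in> ring_hom A R" using that by (auto simp: points_simps)
    define i1 where "i1 = (\<lambda>a\<in>carrier A. pureZ A A a \<one>\<^bsub>A\<^esub>)"
    define i2 where "i2 = (\<lambda>a\<in>carrier A. pureZ A A \<one>\<^bsub>A\<^esub> a)"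
    have ih: "i1 \<in> ring_hom A A2" "i2 \<in> ring_hom A A2"
      unfolding i1_def i2_def by (rule restrict_hom, rule T2.inL_hom T2.inR_hom)+
    have ip: "i1 \<in> carrier (points G A2)" "i2 \<in> carrier (points G A2)"
      using ih by (auto simp: points_simps i1_def i2_def)
    let ?\<Psi> = "copair R g h"
    have \<Psi>: "?\<Psi> \<in> ring_hom A2 R" by (rule cp2_hom[OF R g h])
    interpret \<Psi>: ring_hom_cring A2 R ?\<Psi>
      by (intro ring_hom_cringI ring_hom_ringI2 T2.T.is_cring R T2.T.ring_axioms R.ring_axioms \<Psi>)
    have \<Psi>i: "?\<Psi> (i1 a) = g a" "?\<Psi> (i2 a) = h a" if "a \<in> carrier A" for a
      using that ring_hom_closed[OF g] ring_hom_closed[OF h]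
      by (simp_all add: i1_def i2_def cp2_pt[OF R g h] ring_hom_one[OF g] ring_hom_one[OF h])
    have ic: "i1 a \<in> carrier A2" "i2 a \<in> carrier A2" if "a \<in> carrier A" for a
      using that ring_hom_closed[OF ih(1)] ring_hom_closed[OF ih(2)] by auto
    have "copair R g h (\<Delta> (?x i j)) = (\<Oplus>\<^bsub>R\<^esub>k\<in>UNIV. g (?x i k) \<otimes>\<^bsub>R\<^esub> h (?x k j))" for i j
    proof -
      have "rep_matrix \<pi> (i1 \<otimes>\<^bsub>points G A2\<^esub> i2) i j = (rep_matrix \<pi> i1 \<otimes>\<^bsub>GL A2\<^esub> rep_matrix \<pi> i2) i j"
        using hom_mult[OF repT ip] by simp
      then have "copair A2 i1 i2 (\<Delta> (?x i j)) = (\<Oplus>\<^bsub>A2\<^esub>k\<in>UNIV. i1 (?x i k) \<otimes>\<^bsub>A2\<^esub> i2 (?x k j))"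
        by (simp add: rep_matrix_def points_simps GL_simps x)
      then have "?\<Psi> (copair A2 i1 i2 (\<Delta> (?x i j))) = (\<Oplus>\<^bsub>R\<^esub>k\<in>UNIV. g (?x i k) \<otimes>\<^bsub>R\<^esub> h (?x k j))"
        by (simp add: \<Psi>.hom_finsum Pi_iff x ic \<Psi>i comp_def)
      moreover have "?\<Psi> (copair A2 i1 i2 (\<Delta> (?x i j))) = copair R g h (\<Delta> (?x i j))"
        by (rule cp2_nat[OF T2.T.is_cring R ih \<Psi>]) (auto simp: \<Psi>i x)
      ultimately show ?thesis by simp
    qed
    then show ?thesis
      by (simp add: rep_matrix_def points_simps GL_simps x)
  qed
  have one: "rep_matrix \<pi> \<one>\<^bsub>points G R\<^esub> = \<one>\<^bsub>GL R\<^esub>"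
  proof -
    have e: "(\<lambda>a. int_map R (\<epsilon> a)) \<in> ring_hom A R" by (rule counit_hom[OF R.ring_axioms])
    let ?\<Psi> = "copair R (\<lambda>a. int_map R (\<epsilon> a)) (\<lambda>a. int_map R (\<epsilon> a))"
    have \<Psi>: "?\<Psi> \<in> ring_hom A2 R" by (rule cp2_hom[OF R e e])
    have "rep_matrix \<pi> \<one>\<^bsub>points G A2\<^esub> = \<one>\<^bsub>GL A2\<^esub>"
      by (rule hom_one[OF repT points_group[OF T2.T.is_cring] GL_group[OF T2.T.is_cring]])
    then have "int_map A2 (\<epsilon> (?x i j)) = (if i = j then \<one>\<^bsub>A2\<^esub> else \<zero>\<^bsub>A2\<^esub>)" for i j
      by (simp add: rep_matrix_def points_simps GL_simps x fun_eq_iff)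
    then have "?\<Psi> (int_map A2 (\<epsilon> (?x i j))) = (if i = j then \<one>\<^bsub>R\<^esub> else \<zero>\<^bsub>R\<^esub>)" for i j
      using ring_hom_one[OF \<Psi>] ring_hom_zero[OF \<Psi> T2.T.ring_axioms R.ring_axioms] by simp
    then show ?thesis
      by (simp add: rep_matrix_def points_simps GL_simps x fun_eq_iff
          ring_hom_int_map[OF T2.T.ring_axioms R.ring_axioms \<Psi>])
  qed
  show ?thesis
  proof (rule homI)
    fix g assume g: "g \<in> carrier (points G R)"
    have c: "rep_matrix \<pi> h \<in> carrier (mat_monoid R)" if "h \<in> carrier (points G R)" for h
      using that ring_hom_closed[of h A R, OF _ x]
      by (auto simp: mat_monoid_def rep_matrix_def points_simps)
    let ?h = "inv\<^bsub>points G R\<^esub> g"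
    have h: "?h \<in> carrier (points G R)" using g by simp
    have "rep_matrix \<pi> g \<otimes>\<^bsub>mat_monoid R\<^esub> rep_matrix \<pi> ?h = \<one>\<^bsub>mat_monoid R\<^esub>"
         "rep_matrix \<pi> ?h \<otimes>\<^bsub>mat_monoid R\<^esub> rep_matrix \<pi> g = \<one>\<^bsub>mat_monoid R\<^esub>"
      using mult[OF g h] mult[OF h g] one g by (simp_all add: GL_def units_of_def)
    then show "rep_matrix \<pi> g \<in> carrier (GL R)"
      using c[OF g] c[OF h] by (auto simp: GL_def units_of_def Units_def)
  qed (use mult in auto)
qed

theorem faithful_all:
  fixes \<pi> :: "('n::finite \<times> 'n) poly_int \<Rightarrow> 'a" and R :: "('r, 'm) ring_scheme"
  assumes rep: "faithful_representation G \<pi>" and R: "cring R"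
  shows "inj_on (rep_matrix \<pi>) (carrier (points G R))"
proof (rule inj_onI)
  fix g h assume gh: "g \<in> carrier (points G R)" "h \<in> carrier (points G R)"
    and eq: "rep_matrix \<pi> g = rep_matrix \<pi> h"
  have g: "g \<in> ring_hom A R" and h: "h \<in> ring_hom A R"
    and ge: "g \<in> extensional (carrier A)" and he: "h \<in> extensional (carrier A)"
    using gh by (auto simp: points_simps)
  have rep': "representation G \<pi>" using rep by (simp add: faithful_representation_def)
  note pc = rep_closed[OF rep']
  interpret T: tensor_data A A poly_ring \<pi> \<pi>
    by unfold_locales (simp_all add: pc)
  let ?T = "tensor_ring poly_ring \<pi> \<pi> A A"
  let ?pt = "pure_tensor poly_ring \<pi> \<pi> A A"
  have "(g \<circ> \<pi>) p = (h \<circ> \<pi>) p" for p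
    by (rule poly_hom_eqI[OF R ring_hom_trans[OF rep_hom[OF rep'] g] ring_hom_trans[OF rep_hom[OF rep'] h]])
      (use eq in \<open>auto simp: rep_matrix_def fun_eq_iff split_paired_all\<close>)
  then have agr: "g (\<pi> p) = h (\<pi> p)" for p by simp
  note pt = T.copair_pt[OF R g h agr]
  define i1 where "i1 = (\<lambda>a\<in>carrier A. ?pt a \<one>\<^bsub>A\<^esub>)"
  define i2 where "i2 = (\<lambda>a\<in>carrier A. ?pt \<one>\<^bsub>A\<^esub> a)"
  have "i1 \<in> ring_hom A ?T" "i2 \<in> ring_hom A ?T"
    unfolding i1_def i2_def by (rule restrict_hom, rule T.inL_hom T.inR_hom)+
  then have ip: "i1 \<in> carrier (points G ?T)" "i2 \<in> carrier (points G ?T)"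
    by (auto simp: points_simps i1_def i2_def)
  have "rep_matrix \<pi> i1 = rep_matrix \<pi> i2"
    by (simp add: rep_matrix_def i1_def i2_def pc T.in_commute)
  moreover have "inj_on (rep_matrix \<pi>) (carrier (points G ?T))"
    using rep T.T.is_cring unfolding faithful_representation_def by blast
  ultimately have i: "i1 = i2" using ip by (auto dest: inj_onD)
  have "g a = h a" if a: "a \<in> carrier A" for a
  proof -
    have "?pt a \<one>\<^bsub>A\<^esub> = ?pt \<one>\<^bsub>A\<^esub> a" using fun_cong[OF i, of a] a by (simp add: i1_def i2_def)
    then have "copair R g h (?pt a \<one>\<^bsub>A\<^esub>) = copair R g h (?pt \<one>\<^bsub>A\<^esub> a)" by simp
    moreover interpret R: cring R by fact
    show ?thesis using calculation a ring_hom_closed[OF g a] ring_hom_closed[OF h a]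
      by (simp add: pt ring_hom_one[OF g] ring_hom_one[OF h])
  qed
  then show "g = h" using ge he by (auto intro: extensionalityI)
qed

lemma phi_hom: "(phi :: ('n \<times> 'n) poly_int \<Rightarrow> _) \<in> ring_hom poly_ring poly_ring"
  unfolding phi_def by (rule poly_eval_hom[OF poly_ring_cring]) simp

lemma phi_pvar: "phi (pvar (i, j)) = (if i = j then 1 else 0) + pvar None * pvar (Some (i, j))"
  unfolding phi_def by (subst poly_eval_pvar[OF poly_ring_cring]) simp_all

lemma D_tensor_data:
  "representation G \<pi> \<Longrightarrow> tensor_data poly_ring A poly_ring phi \<pi>"
  by (simp add: tensor_data_def poly_ring_cring A.is_cring tensor_data_axioms_def rep_closed)

lemma D_cring: "representation G \<pi> \<Longrightarrow> cring (D_ring G \<pi>)"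
proof -
  assume "representation G \<pi>"
  then interpret T: tensor_data poly_ring A poly_ring phi \<pi> by (rule D_tensor_data)
  show ?thesis unfolding D_ring_def by (rule T.T.is_cring)
qed

lemma congruence_iff:
  assumes R: "cring R" and q: "ideal \<qq> R"
  shows "h \<in> congruence_subgroup G R \<qq> \<longleftrightarrow>
    h \<in> carrier (points G R) \<and>
    (\<forall>a\<in>carrier A. \<qq> +>\<^bsub>R\<^esub> h a = int_map (R Quot \<qq>) (\<epsilon> a))"
  by (auto simp: congruence_subgroup_def kernel_def points_simps point_map_def compose_def
      restrict_def fun_eq_iff)

text \<open>\<open>f \<in> G(D, tD)\<close> and \<open>\<pi>(f) = e + ty\<close>.\<close>

theorem D_f_congruence:
  fixes \<pi> :: "('n::finite \<times> 'n) poly_int \<Rightarrow> 'a"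
  assumes rep: "faithful_representation G \<pi>"
  shows "D_f G \<pi> \<in> congruence_subgroup G (D_ring G \<pi>) (PIdl\<^bsub>D_ring G \<pi>\<^esub> (D_t G \<pi>))"
    and "rep_matrix \<pi> (D_f G \<pi>) i j =
      (if i = j then \<one>\<^bsub>D_ring G \<pi>\<^esub> else \<zero>\<^bsub>D_ring G \<pi>\<^esub>)
        \<oplus>\<^bsub>D_ring G \<pi>\<^esub> D_t G \<pi> \<otimes>\<^bsub>D_ring G \<pi>\<^esub> D_y G \<pi> i j"
proof -
  have rep': "representation G \<pi>" using rep by (simp add: faithful_representation_def)
  interpret T: tensor_data poly_ring A poly_ring phi \<pi> by (rule D_tensor_data[OF rep'])
  let ?D = "D_ring G \<pi>"
  let ?t = "D_t G \<pi>"
  let ?I = "PIdl\<^bsub>?D\<^esub> ?t"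
  interpret D: cring ?D unfolding D_ring_def by (rule T.T.is_cring)
  have P: "D_poly G \<pi> \<in> ring_hom poly_ring ?D"
    unfolding D_poly_def[abs_def] D_ring_def by (rule T.inL_hom)
  have f: "D_f G \<pi> \<in> ring_hom A ?D"
    unfolding D_f_def D_ring_def using T.inR_hom by (intro restrict_hom) simp
  have t: "?t \<in> carrier ?D" "D_y G \<pi> i j \<in> carrier ?D" for i j
    unfolding D_t_def D_y_def using ring_hom_closed[OF P] by auto
  have fm: "rep_matrix \<pi> (D_f G \<pi>) i j =
      (if i = j then \<one>\<^bsub>?D\<^esub> else \<zero>\<^bsub>?D\<^esub>) \<oplus>\<^bsub>?D\<^esub> ?t \<otimes>\<^bsub>?D\<^esub> D_y G \<pi> i j" for i j
  proof -
    have "rep_matrix \<pi> (D_f G \<pi>) i j = D_poly G \<pi> (phi (pvar (i, j)))"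
      using T.in_commute[of "pvar (i, j)"]
      by (simp add: rep_matrix_def D_f_def D_poly_def rep_closed[OF rep'])
    also have "\<dots> = (if i = j then \<one>\<^bsub>?D\<^esub> else \<zero>\<^bsub>?D\<^esub>) \<oplus>\<^bsub>?D\<^esub> ?t \<otimes>\<^bsub>?D\<^esub> D_y G \<pi> i j"
      using ring_hom_add[OF P, of "if i = j then 1 else 0" "pvar None * pvar (Some (i, j))"]
        ring_hom_mult[OF P, of "pvar None" "pvar (Some (i, j))"] ring_hom_one[OF P]
        ring_hom_zero[OF P cring.axioms(1)[OF poly_ring_cring] D.ring_axioms]
      by (simp add: phi_pvar D_t_def D_y_def)
    finally show ?thesis .
  qed
  then show "rep_matrix \<pi> (D_f G \<pi>) i j =
      (if i = j then \<one>\<^bsub>?D\<^esub> else \<zero>\<^bsub>?D\<^esub>) \<oplus>\<^bsub>?D\<^esub> ?t \<otimes>\<^bsub>?D\<^esub> D_y G \<pi> i j" .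
  interpret I: ideal ?I ?D by (rule D.cgenideal_ideal[OF t(1)])
  have Q: "cring (?D Quot ?I)" by (rule I.quotient_is_cring[OF D.is_cring])
  interpret Q: cring "?D Quot ?I" by (rule Q)
  have q: "(+>\<^bsub>?D\<^esub>) ?I \<in> ring_hom ?D (?D Quot ?I)" by (rule I.rcos_ring_hom)
  have qt: "?I +>\<^bsub>?D\<^esub> ?t = \<zero>\<^bsub>?D Quot ?I\<^esub>"
    using D.cgenideal_self[OF t(1)] by (simp add: FactRing_def I.a_rcos_const)
  let ?g = "point_map G ((+>\<^bsub>?D\<^esub>) ?I) (D_f G \<pi>)"
  have g: "?g \<in> carrier (points G (?D Quot ?I))"
    using restrict_hom[OF ring_hom_trans[OF f q]]
    by (simp add: points_simps point_map_def compose_def comp_def)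
  have fc: "D_f G \<pi> a \<in> carrier ?D" if "a \<in> carrier A" for a
    by (rule ring_hom_closed[OF f that])
  have "rep_matrix \<pi> ?g i j = (if i = j then \<one>\<^bsub>?D Quot ?I\<^esub> else \<zero>\<^bsub>?D Quot ?I\<^esub>)" for i j
  proof -
    have c1: "(if i = j then \<one>\<^bsub>?D\<^esub> else \<zero>\<^bsub>?D\<^esub>) \<in> carrier ?D" by simp
    have c2: "?t \<otimes>\<^bsub>?D\<^esub> D_y G \<pi> i j \<in> carrier ?D" using t by simp
    have "rep_matrix \<pi> ?g i j = ?I +>\<^bsub>?D\<^esub> rep_matrix \<pi> (D_f G \<pi>) i j"
      by (simp add: rep_matrix_def point_map_def compose_def rep_closed[OF rep'])
    also have "\<dots> = (?I +>\<^bsub>?D\<^esub> (if i = j then \<one>\<^bsub>?D\<^esub> else \<zero>\<^bsub>?D\<^esub>)) \<oplus>\<^bsub>?D Quot ?I\<^esub>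
        \<zero>\<^bsub>?D Quot ?I\<^esub> \<otimes>\<^bsub>?D Quot ?I\<^esub> (?I +>\<^bsub>?D\<^esub> D_y G \<pi> i j)"
      unfolding fm ring_hom_add[OF q c1 c2] ring_hom_mult[OF q t] qt ..
    also have "\<dots> = (?I +>\<^bsub>?D\<^esub> (if i = j then \<one>\<^bsub>?D\<^esub> else \<zero>\<^bsub>?D\<^esub>))"
      using ring_hom_closed[OF q c1] ring_hom_closed[OF q t(2)[of i j]] by (simp only: Q.l_null Q.r_zero)
    also have "\<dots> = (if i = j then \<one>\<^bsub>?D Quot ?I\<^esub> else \<zero>\<^bsub>?D Quot ?I\<^esub>)"
      using ring_hom_one[OF q] ring_hom_zero[OF q D.ring_axioms Q.ring_axioms] by simp
    finally show ?thesis .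
  qed
  then have "rep_matrix \<pi> ?g = \<one>\<^bsub>GL (?D Quot ?I)\<^esub>" by (simp add: GL_simps fun_eq_iff)
  also have "\<dots> = rep_matrix \<pi> \<one>\<^bsub>points G (?D Quot ?I)\<^esub>"
    by (rule hom_one[OF representation_all[OF rep' Q] points_group[OF Q] GL_group[OF Q], symmetric])
  finally have "?g = \<one>\<^bsub>points G (?D Quot ?I)\<^esub>"
    using inj_onD[OF faithful_all[OF rep Q]] g
      group.is_monoid[OF points_group[OF Q], THEN monoid.one_closed] by blast
  then show "D_f G \<pi> \<in> congruence_subgroup G ?D ?I"
    using f by (simp add: congruence_subgroup_def kernel_def points_simps(1) D_f_def)
qed

end

end

theory Submission
  imports Defs
begin

text \<open>A homomorphism \<open>D \<rightarrow> R\<close> out of the pushout amounts to \<open>r\<close>, a matrix \<open>u\<close> over \<open>R\<close>, and a point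
  \<open>h \<in> G(R)\<close> such that \<open>\<pi>(h) = e + ru\<close>. If \<open>h \<in> G(R, r\<aa>)\<close>, then \<open>\<pi>(h)\<close> is congruent to \<open>e\<close> modulo
  \<open>r\<aa>\<close>, because \<open>\<pi>\<close> maps the neutral element of \<open>G(R/r\<aa>)\<close> to \<open>e\<close>; so \<open>u\<close> can be chosen with entries
  in \<open>\<aa>\<close>. The case of \<open>rR\<close> is \<open>\<aa> = R\<close>.\<close>

text \<open>The multiples of \<open>r\<close> by elements of \<open>I\<close> already form an ideal,
  with no sums to add. So \<open>R Quot (r <# I)\<close> is a ring, and every element of the ideal
  has a single factor in \<open>I\<close>.\<close>

lemma (in cring) ideal_l_coset:
  assumes I: "ideal I R" and r: "r \<in> carrier R"
  shows "ideal (r <# I) R"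
proof -
  interpret I: ideal I R by fact
  show ?thesis
  proof (rule idealI[OF ring_axioms])
    show "subgroup (r <# I) (add_monoid R)"
    proof (rule add.subgroupI)
      show "r <# I \<subseteq> carrier R" using r I.Icarr by (auto simp: l_coset_def)
      show "r <# I \<noteq> {}" unfolding l_coset_def using I.zero_closed by blast
    next
      fix x assume "x \<in> r <# I"
      then obtain a where a: "a \<in> I" "x = r \<otimes> a" by (auto simp: l_coset_def)
      then have "\<ominus> x = r \<otimes> (\<ominus> a)" using r I.Icarr by (simp add: r_minus)
      then show "\<ominus> x \<in> r <# I" using a by (auto simp: l_coset_def)
    next
      fix x y assume "x \<in> r <# I" "y \<in> r <# I"
      then obtain a b where ab: "a \<in> I" "x = r \<otimes> a" "b \<in> I" "y = r \<otimes> b" by (auto simp: l_coset_def)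
      then have "x \<oplus> y = r \<otimes> (a \<oplus> b)" using r I.Icarr by (simp add: r_distr)
      then show "x \<oplus> y \<in> r <# I" using ab by (auto simp: l_coset_def)
    qed
  next
    fix a x assume "a \<in> r <# I" and x: "x \<in> carrier R"
    then obtain b where b: "b \<in> I" "a = r \<otimes> b" by (auto simp: l_coset_def)
    have "x \<otimes> a = r \<otimes> (x \<otimes> b)" using r b x I.Icarr by (simp add: m_lcomm)
    then show "x \<otimes> a \<in> r <# I" using b I.I_l_closed[OF b(1) x] by (auto simp: l_coset_def)
    moreover have "a \<otimes> x = x \<otimes> a" using b r x I.Icarr by (simp add: m_comm)
    ultimately show "a \<otimes> x \<in> r <# I" by simp
  qed
qed

text \<open>Reduces congruences modulo \<open>PIdl r\<close> to the case where the ideal \<aa> is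
  the whole ring.\<close>

lemma (in cring) cgenideal_eq_l_coset:
  assumes "r \<in> carrier R"
  shows "PIdl r = r <# carrier R"
  using assms by (auto simp: cgenideal_def l_coset_def m_comm)

context gscheme
begin

text \<open>The image of \<open>h\<close> in the points over \<open>R Quot \<qq>\<close> is neutral,
  and the representation over that quotient sends the neutral point to the identity matrix.\<close>

lemma congruence_rep_matrix:
  fixes \<pi> :: "('n::finite \<times> 'n) poly_int \<Rightarrow> 'a" and R :: "('r, 'm) ring_scheme"
  assumes rep: "representation G \<pi>" and R: "cring R" and q: "ideal \<qq> R"
    and h: "h \<in> congruence_subgroup G R \<qq>"
  shows "rep_matrix \<pi> h i j \<ominus>\<^bsub>R\<^esub> (if i = j then \<one>\<^bsub>R\<^esub> else \<zero>\<^bsub>R\<^esub>) \<in> \<qq>"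
proof -
  interpret R: cring R by fact
  interpret q: ideal \<qq> R by fact
  let ?Q = "R Quot \<qq>"
  let ?e = "if i = j then \<one>\<^bsub>R\<^esub> else \<zero>\<^bsub>R\<^esub>"
  have Q: "cring ?Q" by (rule q.quotient_is_cring[OF R])
  have p: "(+>\<^bsub>R\<^esub>) \<qq> \<in> ring_hom R ?Q" by (rule q.rcos_ring_hom)
  have hA: "h \<in> ring_hom A R"
    and hq: "\<And>a. a \<in> carrier A \<Longrightarrow> \<qq> +>\<^bsub>R\<^esub> h a = int_map ?Q (\<epsilon> a)"
    using h by (auto simp: congruence_iff[OF R q] points_simps)
  note x = rep_closed[OF rep]
  \<comment> \<open>The quotient is carried by sets of elements of \<open>R\<close>, hence the
    appeal to \<open>representation_all\<close>, which covers rings over any type.\<close>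
  have "rep_matrix \<pi> \<one>\<^bsub>points G ?Q\<^esub> = \<one>\<^bsub>GL ?Q\<^esub>"
    by (rule hom_one[OF representation_all[OF rep Q] points_group[OF Q] GL_group[OF Q]])
  then have "int_map ?Q (\<epsilon> (\<pi> (pvar (i, j)))) = (if i = j then \<one>\<^bsub>?Q\<^esub> else \<zero>\<^bsub>?Q\<^esub>)"
    by (simp add: rep_matrix_def points_simps GL_simps x fun_eq_iff)
  then have "\<qq> +>\<^bsub>R\<^esub> rep_matrix \<pi> h i j = (if i = j then \<one>\<^bsub>?Q\<^esub> else \<zero>\<^bsub>?Q\<^esub>)"
    by (simp add: rep_matrix_def hq x)
  also have "\<dots> = \<qq> +>\<^bsub>R\<^esub> ?e"
    using ring_hom_one[OF p] ring_hom_zero[OF p R.ring_axioms cring.axioms(1)[OF Q]] by simp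
  finally show ?thesis
    using ring_hom_closed[OF hA x]
    by (subst R.quotient_eq_iff_same_a_r_cos[OF q]) (auto simp: rep_matrix_def)
qed

text \<open>Universal property of the pushout: evaluation at \<open>r\<close> and \<open>u\<close>
  and the point \<open>h\<close> glue to a map out of D once they agree on the coordinate ring of
  the matrix scheme. It suffices to compare them on the variables, where agreement is
  \<open>hm\<close>.\<close>

lemma D_universal:
  fixes \<pi> :: "('n::finite \<times> 'n) poly_int \<Rightarrow> 'a" and R :: "('r, 'm) ring_scheme"
  assumes rep: "representation G \<pi>" and R: "cring R" and r: "r \<in> carrier R"
    and u: "\<And>i j. u i j \<in> carrier R" and h: "h \<in> carrier (points G R)"
    and hm: "\<And>i j. rep_matrix \<pi> h i j =
      (if i = j then \<one>\<^bsub>R\<^esub> else \<zero>\<^bsub>R\<^esub>) \<oplus>\<^bsub>R\<^esub> r \<otimes>\<^bsub>R\<^esub> u i j"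
  obtains \<theta> where "\<theta> \<in> ring_hom (D_ring G \<pi>) R" "\<theta> (D_t G \<pi>) = r"
    "point_map G \<theta> (D_f G \<pi>) = h" "\<And>i j. \<theta> (D_y G \<pi> i j) = u i j"
proof -
  interpret R: cring R by fact
  interpret T: tensor_data poly_ring A poly_ring phi \<pi> by (rule D_tensor_data[OF rep])
  have hA: "h \<in> ring_hom A R" and he: "h \<in> extensional (carrier A)"
    using h by (auto simp: points_simps)
  \<comment> \<open>\<open>None\<close> is the variable t and \<open>Some (i, j)\<close> is the
    variable \<open>y\<^sub>i\<^sub>j\<close>.\<close>
  define \<rho> where "\<rho> = case_option r (\<lambda>(i, j). u i j)"
  have \<rho>: "\<rho> v \<in> carrier R" for v using r u by (auto simp: \<rho>_def split: option.split)
  define g where "g = poly_eval R \<rho>"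
  have g: "g \<in> ring_hom poly_ring R" unfolding g_def by (rule poly_eval_hom[OF R \<rho>])
  have gv: "g (pvar v) = \<rho> v" for v unfolding g_def by (rule poly_eval_pvar[OF R \<rho>])
  have g0: "g 0 = \<zero>\<^bsub>R\<^esub>"
    using ring_hom_zero[OF g cring.axioms(1)[OF poly_ring_cring] R.ring_axioms] by simp
  have g1: "g 1 = \<one>\<^bsub>R\<^esub>" using ring_hom_one[OF g] by simp
  have gphi: "g (phi (pvar (i, j))) = h (\<pi> (pvar (i, j)))" for i j
    using ring_hom_add[OF g, of "if i = j then 1 else 0" "pvar None * pvar (Some (i, j))"]
      ring_hom_mult[OF g, of "pvar None" "pvar (Some (i, j))"] hm[of i j]
    by (simp add: phi_pvar gv \<rho>_def g0 g1 rep_matrix_def)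
  have "(g \<circ> phi) p = (h \<circ> \<pi>) p" for p
    by (rule poly_hom_eqI[OF R ring_hom_trans[OF phi_hom g] ring_hom_trans[OF rep_hom[OF rep] hA]])
      (auto simp: gphi)
  then have agr: "g (phi p) = h (\<pi> p)" for p by simp
  note pt = T.copair_pt[OF R g hA agr]
  let ?\<theta> = "copair R g h"
  have poly: "?\<theta> (D_poly G \<pi> p) = g p" for p
    using ring_hom_closed[OF g, of p] by (simp add: D_poly_def pt ring_hom_one[OF hA])
  have "?\<theta> (D_f G \<pi> a) = h a" if "a \<in> carrier A" for a
    using that ring_hom_closed[OF hA that] by (simp add: D_f_def pt g1)
  \<comment> \<open>Off the carrier of \<open>A\<close> both functions are \<open>undefined\<close>,
    so agreement on the carrier suffices.\<close>
  then have "point_map G ?\<theta> (D_f G \<pi>) = h"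
    using he by (auto simp: point_map_def compose_def fun_eq_iff extensional_def)
  moreover have "?\<theta> \<in> ring_hom (D_ring G \<pi>) R"
    unfolding D_ring_def by (rule T.copair_hom[OF R g hA agr])
  ultimately show ?thesis
    using that[of ?\<theta>] by (simp add: D_t_def D_y_def poly gv \<rho>_def)
qed

lemma D_lift:
  fixes \<pi> :: "('n::finite \<times> 'n) poly_int \<Rightarrow> 'a" and R :: "('r, 'm) ring_scheme"
  assumes rep: "representation G \<pi>" and R: "cring R" and I: "ideal \<aa> R" and r: "r \<in> carrier R"
    and h: "h \<in> congruence_subgroup G R (r <#\<^bsub>R\<^esub> \<aa>)"
  shows "\<exists>\<theta>\<in>ring_hom (D_ring G \<pi>) R. \<theta> (D_t G \<pi>) = r \<and> point_map G \<theta> (D_f G \<pi>) = h \<and>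
    (\<forall>i j. \<theta> (D_y G \<pi> i j) \<in> \<aa>)"
proof -
  interpret R: cring R by fact
  interpret I: ideal \<aa> R by fact
  let ?e = "\<lambda>i j. if i = j then \<one>\<^bsub>R\<^esub> else \<zero>\<^bsub>R\<^esub>"
  have q: "ideal (r <#\<^bsub>R\<^esub> \<aa>) R" by (rule R.ideal_l_coset[OF I r])
  have hp: "h \<in> carrier (points G R)" using h by (simp add: congruence_iff[OF R q])
  then have hc: "rep_matrix \<pi> h i j \<in> carrier R" for i j
    using ring_hom_closed[of h A R] rep_closed[OF rep] by (simp add: points_simps rep_matrix_def)
  \<comment> \<open>Since \<open>r\<close> may be a zero divisor, the factor \<open>u\<close> need
    not be unique; one is chosen for each entry.\<close>
  have "\<exists>u\<in>\<aa>. rep_matrix \<pi> h i j = ?e i j \<oplus>\<^bsub>R\<^esub> r \<otimes>\<^bsub>R\<^esub> u" for i j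
  proof -
    obtain u where u: "u \<in> \<aa>" "rep_matrix \<pi> h i j \<ominus>\<^bsub>R\<^esub> ?e i j = r \<otimes>\<^bsub>R\<^esub> u"
      using congruence_rep_matrix[OF rep R q h, of i j] by (auto simp: l_coset_def)
    have "rep_matrix \<pi> h i j = ?e i j \<oplus>\<^bsub>R\<^esub> (rep_matrix \<pi> h i j \<ominus>\<^bsub>R\<^esub> ?e i j)"
      using hc[of i j] by (simp add: R.minus_eq R.a_lcomm R.r_neg)
    with u show ?thesis by auto
  qed
  then obtain u where u: "\<And>i j. u i j \<in> \<aa>"
    and hm: "\<And>i j. rep_matrix \<pi> h i j = ?e i j \<oplus>\<^bsub>R\<^esub> r \<otimes>\<^bsub>R\<^esub> u i j"
    by metis
  obtain \<theta> where "\<theta> \<in> ring_hom (D_ring G \<pi>) R" "\<theta> (D_t G \<pi>) = r"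
    "point_map G \<theta> (D_f G \<pi>) = h" "\<And>i j. \<theta> (D_y G \<pi> i j) = u i j"
    using D_universal[OF rep R r I.Icarr[OF u] hp hm] by blast
  then show ?thesis using u by auto
qed

end

theorem proposition6p5:
  fixes G :: "'a group_scheme"
    and \<pi> :: "('n::finite \<times> 'n) poly_int \<Rightarrow> 'a"
  assumes "affine_group_scheme G" and "flat G" and "finite_type G"
    and "faithful_representation G \<pi>"
  shows "(\<forall>(R :: 'r ring) r h.
            cring R \<and> r \<in> carrier R \<and> h \<in> congruence_subgroup G R (PIdl\<^bsub>R\<^esub> r) \<longrightarrow>
            (\<exists>\<theta>\<in>ring_hom (D_ring G \<pi>) R.
               \<theta> (D_t G \<pi>) = r \<and> point_map G \<theta> (D_f G \<pi>) = h)) \<and>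
         (\<forall>(R :: 'r ring) \<aa> r h.
            cring R \<and> ideal \<aa> R \<and> r \<in> carrier R \<and>
            h \<in> congruence_subgroup G R (r <#\<^bsub>R\<^esub> \<aa>) \<longrightarrow>
            (\<exists>\<theta>\<in>ring_hom (D_ring G \<pi>) R.
               \<theta> (D_t G \<pi>) = r \<and> point_map G \<theta> (D_f G \<pi>) = h \<and>
               (\<forall>i j. \<theta> (D_y G \<pi> i j) \<in> \<aa>)))"
proof -
  interpret gscheme G by unfold_locales fact
  have rep: "representation G \<pi>" using assms(4) by (simp add: faithful_representation_def)
  show ?thesis
  proof (intro conjI allI impI; elim conjE)
    fix R :: "'r ring" and r h
    assume R: "cring R" and r: "r \<in> carrier R" and h: "h \<in> congruence_subgroup G R (PIdl\<^bsub>R\<^esub> r)"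
    interpret R: cring R by fact
    show "\<exists>\<theta>\<in>ring_hom (D_ring G \<pi>) R. \<theta> (D_t G \<pi>) = r \<and> point_map G \<theta> (D_f G \<pi>) = h"
      \<comment> \<open>With \<aa> the whole ring, the condition on the images of the
        \<open>D_y G \<pi> i j\<close> only says that they lie in \<open>R\<close>, and is
        dropped.\<close>
      using D_lift[OF rep R R.oneideal r] h by (auto simp: R.cgenideal_eq_l_coset[OF r])
  qed (rule D_lift[OF rep])
qed

end
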